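(* Let $\mathcal{A}$ be a Banach algebra and let $\sigma\in Hom(\mathcal{A})$. Then the following are equivalent: (i) $\mathcal{A}$ is $\sigma$-biflat; (ii) there is a $\sigma$-$\mathcal{A}$-bimodule homomorphism $\rho:\mathcal{A}\rightarrow(\mathcal{A}\widehat{\otimes}\mathcal{A})^{**}$ such that $\pi^{**}\circ\rho=\kappa_{\mathcal{A}}\circ\sigma$, where $\kappa_{\mathcal{A}}$ is the canonical embedding of $\mathcal{A}$ into $\mathcal{A}^{**}$.
   Context: $Hom(\mathcal{A})$ is the set of all continuous algebra homomorphisms $\mathcal{A}\to\mathcal{A}$. The projective tensor product $\mathcal{A}\widehat{\otimes}\mathcal{A}$ is a Banach $\mathcal{A}$-bimodule via $a\cdot(b\otimes c)=ab\otimes c$ and $(b\otimes c)\cdot a=b\otimes ca$. The diagonal operator is $\pi:\mathcal{A}\widehat{\otimes}\mathcal{A}\to\mathcal{A}$, $\pi(a\otimes b)=ab$. For a Banach $\mathcal{A}$-bimodule $X$, the dual $X^*$ is a Banach $\mathcal{A}$-bimodule via $\langle a\cdot\lambda,x\rangle=\langle\lambda,x\cdot a\rangle$ and $\langle\lambda\cdot a,x\rangle=\langle\lambda,a\cdot x\rangle$; biduals are bimodules by iterating this. For Banach $\mathcal{A}$-bimodules $X,Y$, a bounded linear map $T:X\to Y$ is a $\sigma$-$\mathcal{A}$-bimodule homomorphism if $T(a\cdot x)=\sigma(a)\cdot T(x)$ and $T(x\cdot a)=T(x)\cdot\sigma(a)$ for all $a\in\mathcal{A}$, $x\in X$. $\mathcal{A}$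 is $\sigma$-biflat if there exists a bounded linear map $\rho:(\mathcal{A}\widehat{\otimes}\mathcal{A})^*\to\mathcal{A}^*$ such that $\rho(\sigma(a)\cdot\lambda)=a\cdot\rho(\lambda)$ and $\rho(\lambda\cdot\sigma(a))=\rho(\lambda)\cdot a$ for all $a\in\mathcal{A}$, $\lambda\in(\mathcal{A}\widehat{\otimes}\mathcal{A})^*$, and $\rho\circ\pi^*=\sigma^*$. *)

theory Defs
  imports "HOL-Analysis.Analysis" "HOL-Library.Multiset"
begin

(* Banach algebras are over the complex field and need not be unital. The distribution only has
   real normed spaces, so complex scalars are added as subclasses of the real classes. *)
class scaleC =
  fixes scaleC :: "complex \<Rightarrow> 'a \<Rightarrow> 'a"  (infixr \<open>*\<^sub>C\<close> 75)

class complex_vector = real_vector + scaleC +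
  assumes scaleC_add_right: "c *\<^sub>C (x + y) = c *\<^sub>C x + c *\<^sub>C y"
    and scaleC_add_left: "(c + d) *\<^sub>C x = c *\<^sub>C x + d *\<^sub>C x"
    and scaleC_scaleC [simp]: "c *\<^sub>C d *\<^sub>C x = (c * d) *\<^sub>C x"
    and scaleC_one [simp]: "1 *\<^sub>C x = x"
    and scaleR_scaleC: "r *\<^sub>R x = complex_of_real r *\<^sub>C x"

class complex_normed_vector = complex_vector + real_normed_vector +
  assumes norm_scaleC [simp]: "norm (c *\<^sub>C x) = cmod c * norm x"

class complex_normed_algebra = complex_normed_vector + real_normed_algebra +
  assumes mult_scaleC_left [simp]: "(c *\<^sub>C x) * y = c *\<^sub>C (x * y)"
    and mult_scaleC_right [simp]: "x * (c *\<^sub>C y) = c *\<^sub>C (x * y)"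

class complex_banach = complex_normed_vector + banach

class complex_banach_algebra = complex_normed_algebra + complex_banach

instantiation complex :: complex_banach_algebra
begin
definition scaleC_complex :: "complex \<Rightarrow> complex \<Rightarrow> complex"
  where [simp]: "scaleC_complex c z = c * z"
instance
  by standard (auto simp: algebra_simps scaleR_conv_of_real norm_mult)
end

lemma scaleC_zero_right [simp]: "c *\<^sub>C (0::'a::complex_vector) = 0"
  using scaleC_add_right[of c "0::'a" 0] by simp

lemma scaleC_zero_left [simp]: "0 *\<^sub>C (x::'a::complex_vector) = 0"
  using scaleR_scaleC[of 0 x] by simp

lemma scaleC_minus_one: "(- 1) *\<^sub>C (x::'a::complex_vector) = - x"
  using scaleR_scaleC[of "-1" x] by simp

lemma scaleC_minus_right: "c *\<^sub>C (- (x::'a::complex_vector)) = - (c *\<^sub>C x)"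
  using scaleC_add_right[of c x "-x"] by (simp add: eq_neg_iff_add_eq_0 add.commute)

lemma scaleC_diff_right: "c *\<^sub>C (x - (y::'a::complex_vector)) = c *\<^sub>C x - c *\<^sub>C y"
  using scaleC_add_right[of c x "-y"] by (simp add: scaleC_minus_right)

definition bounded_clinear :: "('a::complex_normed_vector \<Rightarrow> 'b::complex_normed_vector) \<Rightarrow> bool"
  where "bounded_clinear f \<longleftrightarrow> bounded_linear f \<and> (\<forall>c x. f (c *\<^sub>C x) = c *\<^sub>C f x)"

definition bounded_cbilinear ::
    "('a::complex_normed_vector \<Rightarrow> 'b::complex_normed_vector \<Rightarrow> 'c::complex_normed_vector) \<Rightarrow> bool"
  where "bounded_cbilinear B \<longleftrightarrow> bounded_bilinear B \<and>
    (\<forall>c x y. B (c *\<^sub>C x) y = c *\<^sub>C B x y \<and> B x (c *\<^sub>C y) = c *\<^sub>C B x y)"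

(* The space of bounded complex-linear functionals; the norm lifted from blinfun below is the
   operator norm. *)
typedef (overloaded) 'a dual =
  "{\<phi> :: 'a::complex_normed_vector \<Rightarrow>\<^sub>L complex. bounded_clinear (blinfun_apply \<phi>)}"
  by (rule exI[of _ 0]) (auto simp: bounded_clinear_def blinfun.bounded_linear_right)

setup_lifting type_definition_dual

lift_definition dual_apply :: "'a::complex_normed_vector dual \<Rightarrow> 'a \<Rightarrow> complex"
  is blinfun_apply .

instantiation dual :: (complex_normed_vector) complex_normed_vector
begin

lift_definition zero_dual :: "'a dual" is 0
  by (auto simp: bounded_clinear_def blinfun.bounded_linear_right)
lift_definition plus_dual :: "'a dual \<Rightarrow> 'a dual \<Rightarrow> 'a dual" is "(+)"
  by (auto simp: bounded_clinear_def blinfun.bounded_linear_right blinfun.add_left distrib_left)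
lift_definition minus_dual :: "'a dual \<Rightarrow> 'a dual \<Rightarrow> 'a dual" is "(-)"
  by (auto simp: bounded_clinear_def blinfun.bounded_linear_right blinfun.diff_left right_diff_distrib)
lift_definition uminus_dual :: "'a dual \<Rightarrow> 'a dual" is uminus
  by (auto simp: bounded_clinear_def blinfun.bounded_linear_right blinfun.minus_left)
lift_definition scaleR_dual :: "real \<Rightarrow> 'a dual \<Rightarrow> 'a dual" is "(*\<^sub>R)"
  by (auto simp: bounded_clinear_def blinfun.bounded_linear_right blinfun.scaleR_left)
lift_definition scaleC_dual :: "complex \<Rightarrow> 'a dual \<Rightarrow> 'a dual"
  is "\<lambda>c \<phi>. blinfun_compose (blinfun_mult_right c) \<phi>"
  by (auto simp: bounded_clinear_def blinfun.bounded_linear_right)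
lift_definition norm_dual :: "'a dual \<Rightarrow> real" is norm .
definition dist_dual :: "'a dual \<Rightarrow> 'a dual \<Rightarrow> real"
  where "dist_dual \<phi> \<psi> = norm (\<phi> - \<psi>)"
definition sgn_dual :: "'a dual \<Rightarrow> 'a dual"
  where "sgn_dual \<phi> = inverse (norm \<phi>) *\<^sub>R \<phi>"
definition uniformity_dual :: "('a dual \<times> 'a dual) filter"
  where "uniformity_dual = (INF e\<in>{0<..}. principal {(x, y). dist x y < e})"
definition open_dual :: "'a dual set \<Rightarrow> bool"
  where "open_dual U \<longleftrightarrow> (\<forall>x\<in>U. \<forall>\<^sub>F (x', y) in uniformity. x' = x \<longrightarrow> y \<in> U)"

lemma norm_scaleC_dual_aux:
  fixes \<phi> :: "'b::complex_normed_vector \<Rightarrow>\<^sub>L complex"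
  shows "norm (blinfun_compose (blinfun_mult_right c) \<phi>) = cmod c * norm \<phi>"
proof (cases "c = 0")
  case True
  have "blinfun_compose (blinfun_mult_right c) \<phi> = 0"
    by (rule blinfun_eqI) (simp add: True)
  then show ?thesis using True by simp
next
  case False
  have le: "norm (blinfun_compose (blinfun_mult_right c) \<phi>) \<le> cmod c * norm \<phi>" for c
    and \<phi> :: "'b \<Rightarrow>\<^sub>L complex"
    by (rule norm_blinfun_bound)
       (auto simp: norm_mult mult.assoc intro!: mult_left_mono norm_blinfun)
  have "blinfun_compose (blinfun_mult_right (inverse c)) (blinfun_compose (blinfun_mult_right c) \<phi>) = \<phi>"
    by (rule blinfun_eqI) (simp add: False field_simps)
  then have "norm \<phi> \<le> cmod (inverse c) * norm (blinfun_compose (blinfun_mult_right c) \<phi>)"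
    using le[of "inverse c" "blinfun_compose (blinfun_mult_right c) \<phi>"] by simp
  then have "cmod c * norm \<phi> \<le> norm (blinfun_compose (blinfun_mult_right c) \<phi>)"
    using False by (simp add: norm_inverse norm_divide field_simps)
  with le[of c \<phi>] show ?thesis by simp
qed

instance
proof
  fix x y z :: "'a dual" and a b :: real and c d :: complex
  show "x + y + z = x + (y + z)" by transfer (simp add: add.assoc)
  show "x + y = y + x" by transfer (simp add: add.commute)
  show "0 + x = x" by transfer simp
  show "- x + x = 0" by transfer simp
  show "x - y = x + - y" by transfer simp
  show "a *\<^sub>R (x + y) = a *\<^sub>R x + a *\<^sub>R y" by transfer (simp add: scaleR_add_right)
  show "(a + b) *\<^sub>R x = a *\<^sub>R x + b *\<^sub>R x" by transfer (simp add: scaleR_add_left)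
  show "a *\<^sub>R b *\<^sub>R x = (a * b) *\<^sub>R x" by transfer simp
  show "1 *\<^sub>R x = x" by transfer simp
  show "c *\<^sub>C (x + y) = c *\<^sub>C x + c *\<^sub>C y"
    by transfer (auto intro!: blinfun_eqI simp: blinfun.add_left algebra_simps)
  show "(c + d) *\<^sub>C x = c *\<^sub>C x + d *\<^sub>C x"
    by transfer (auto intro!: blinfun_eqI simp: blinfun.add_left algebra_simps)
  show "c *\<^sub>C d *\<^sub>C x = (c * d) *\<^sub>C x"
    by transfer (auto intro!: blinfun_eqI simp: algebra_simps)
  show "1 *\<^sub>C x = x" by transfer (auto intro!: blinfun_eqI)
  show "a *\<^sub>R x = complex_of_real a *\<^sub>C x"
    by transfer (auto intro!: blinfun_eqI simp: blinfun.scaleR_left scaleR_conv_of_real)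
  show "dist x y = norm (x - y)" by (rule dist_dual_def)
  show "sgn x = inverse (norm x) *\<^sub>R x" by (rule sgn_dual_def)
  show "uniformity = (INF e\<in>{0<..}. principal {(x, y :: 'a dual). dist x y < e})"
    by (rule uniformity_dual_def)
  show "open U = (\<forall>x\<in>U. \<forall>\<^sub>F (x', y) in uniformity. x' = x \<longrightarrow> y \<in> U)" for U :: "'a dual set"
    by (rule open_dual_def)
  show "(norm x = 0) = (x = 0)" by transfer simp
  show "norm (x + y) \<le> norm x + norm y" by transfer (rule norm_triangle_ineq)
  show "norm (a *\<^sub>R x) = \<bar>a\<bar> * norm x" by transfer simp
  show "norm (c *\<^sub>C x) = cmod c * norm x"
    by transfer (rule norm_scaleC_dual_aux)
qed

end

instance dual :: (complex_normed_vector) complex_banach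
proof
  fix X :: "nat \<Rightarrow> 'a dual"
  assume X: "Cauchy X"
  have d: "dist (Rep_dual x) (Rep_dual y) = dist x y" for x y :: "'a dual"
    by (simp add: dist_norm norm_dual.rep_eq minus_dual.rep_eq)
  have "Cauchy (\<lambda>n. Rep_dual (X n))"
    using X by (simp add: Cauchy_def d)
  then obtain L where L: "(\<lambda>n. Rep_dual (X n)) \<longlonglongrightarrow> L"
    by (meson Cauchy_convergent convergent_def)
  have app: "(\<lambda>n. blinfun_apply (Rep_dual (X n)) x) \<longlonglongrightarrow> blinfun_apply L x" for x
    by (rule blinfun.tendsto[OF L tendsto_const])
  have lin: "blinfun_apply (Rep_dual (X n)) (c *\<^sub>C x) = c * blinfun_apply (Rep_dual (X n)) x" for n c x
    using Rep_dual[of "X n"] by (simp add: bounded_clinear_def)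
  have "blinfun_apply L (c *\<^sub>C x) = c * blinfun_apply L x" for c x
    using LIMSEQ_unique[OF app[of "c *\<^sub>C x"]] tendsto_mult[OF tendsto_const[of c] app[of x]]
    by (simp add: lin)
  then have "bounded_clinear (blinfun_apply L)"
    by (simp add: bounded_clinear_def blinfun.bounded_linear_right)
  then have "Rep_dual (Abs_dual L) = L" by (simp add: Abs_dual_inverse)
  then have "X \<longlonglongrightarrow> Abs_dual L"
    using L by (simp add: lim_sequentially flip: d)
  then show "convergent X" by (auto simp: convergent_def)
qed

(* The functional with underlying function f; meaningful only for bounded complex-linear f
   (dual_apply_functional). *)
definition functional :: "('a::complex_normed_vector \<Rightarrow> complex) \<Rightarrow> 'a dual"
  where "functional f = (THE \<phi>. dual_apply \<phi> = f)"

lemma dual_eqI: "(\<And>x. dual_apply \<phi> x = dual_apply \<psi> x) \<Longrightarrow> \<phi> = \<psi>"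
  by transfer (rule blinfun_eqI)

lemma dual_apply_functional: 
  assumes "bounded_clinear f" shows "dual_apply (functional f) = f"
proof -
  have "bounded_linear f" using assms by (simp add: bounded_clinear_def)
  then have "dual_apply (Abs_dual (Blinfun f)) = f"
    using assms by (simp add: dual_apply.rep_eq Abs_dual_inverse bounded_linear_Blinfun_apply)
  then show ?thesis unfolding functional_def
    by (rule theI) (metis dual_eqI \<open>dual_apply (Abs_dual (Blinfun f)) = f\<close>)
qed

lemma bounded_clinear_dual_apply: "bounded_clinear (dual_apply \<phi>)"
  by transfer simp

lemma norm_dual_apply: "norm (dual_apply \<phi> x) \<le> norm \<phi> * norm x"
  by transfer (rule norm_blinfun)

lemma norm_dual_bound:
  "0 \<le> b \<Longrightarrow> (\<And>x. norm (dual_apply \<phi> x) \<le> b * norm x) \<Longrightarrow> norm \<phi> \<le> b"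
  by transfer (rule norm_blinfun_bound)

lemma dual_apply_simps:
  "dual_apply 0 x = 0"
  "dual_apply (\<phi> + \<psi>) x = dual_apply \<phi> x + dual_apply \<psi> x"
  "dual_apply (c *\<^sub>C \<phi>) x = c * dual_apply \<phi> x"
  "dual_apply (r *\<^sub>R \<phi>) x = r *\<^sub>R dual_apply \<phi> x"
  by (transfer; simp add: blinfun.add_left blinfun.scaleR_left)+

(* The algebraic tensor product by generators and relations. The multiset {#(a1, b1), ..., (an, bn)#}
   stands for the formal sum of the ai (x) bi; scalars are absorbed into the first factor. Additive
   inverses need no rule of their own, as (a, b) + (-a, b) reduces to (0, b) and hence to 0. *)
inductive tensor_eq ::
    "('a::complex_vector \<times> 'b::complex_vector) multiset \<Rightarrow> ('a \<times> 'b) multiset \<Rightarrow> bool"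
where
  refl: "tensor_eq M M"
| sym: "tensor_eq M N \<Longrightarrow> tensor_eq N M"
| trans: "tensor_eq M N \<Longrightarrow> tensor_eq N K \<Longrightarrow> tensor_eq M K"
| cong: "tensor_eq M N \<Longrightarrow> tensor_eq (M + K) (N + K)"
| add_left: "tensor_eq {#(a + a', b)#} {#(a, b), (a', b)#}"
| add_right: "tensor_eq {#(a, b + b')#} {#(a, b), (a, b')#}"
| scale: "tensor_eq {#(c *\<^sub>C a, b)#} {#(a, c *\<^sub>C b)#}"
| zero: "tensor_eq {#(0, b)#} {#}"

lemma tensor_eq_add:
  assumes "tensor_eq M N" "tensor_eq M' N'"
  shows "tensor_eq (M + M') (N + N')"
  using tensor_eq.trans[OF tensor_eq.cong[OF assms(1), of M'] ]
    tensor_eq.cong[OF assms(2), of N] by (simp add: add.commute)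

definition scale_formal ::
    "complex \<Rightarrow> ('a::complex_vector \<times> 'b::complex_vector) multiset \<Rightarrow> ('a \<times> 'b) multiset"
  where "scale_formal c M = {#(c *\<^sub>C a, b). (a, b) \<in># M#}"

lemma scale_formal_simps [simp]:
  "scale_formal c {#} = {#}"
  "scale_formal c (add_mset (a, b) M) = add_mset (c *\<^sub>C a, b) (scale_formal c M)"
  "scale_formal c (M + N) = scale_formal c M + scale_formal c N"
  by (simp_all add: scale_formal_def)

lemma tensor_eq_scale:
  "tensor_eq M N \<Longrightarrow> tensor_eq (scale_formal c M) (scale_formal c N)"
proof (induction rule: tensor_eq.induct)
  case (scale d a b)
  have "tensor_eq {#(d *\<^sub>C c *\<^sub>C a, b)#} {#(c *\<^sub>C a, d *\<^sub>C b)#}" by (rule tensor_eq.scale)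
  then show ?case by (simp add: mult.commute)
qed (auto simp: scaleC_add_right intro: tensor_eq.intros)

lemma scale_formal_scale [simp]: "scale_formal c (scale_formal d M) = scale_formal (c * d) M"
  by (induction M) auto

lemma scale_formal_one [simp]: "scale_formal 1 M = M"
  by (induction M) auto

lemma tensor_eq_scale_add:
  "tensor_eq (scale_formal (c + d) M) (scale_formal c M + scale_formal d M)"
proof (induction M)
  case empty
  show ?case by (simp add: tensor_eq.refl)
next
  case (add x M)
  obtain a b where x: "x = (a, b)" by (cases x)
  show ?case
    using tensor_eq_add[OF tensor_eq.add_left[of "c *\<^sub>C a" "d *\<^sub>C a" b] add]
    by (simp add: x scaleC_add_left add_mset_commute)
qed

lemma tensor_eq_scale_zero: "tensor_eq (scale_formal 0 M) {#}"
proof (induction M)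
  case empty
  show ?case by (simp add: tensor_eq.refl)
next
  case (add x M)
  obtain a b where x: "x = (a, b)" by (cases x)
  show ?case using tensor_eq_add[OF tensor_eq.zero[of b] add] by (simp add: x)
qed

quotient_type (overloaded) ('a, 'b) alg_tensor =
  "('a::complex_vector \<times> 'b::complex_vector) multiset" / tensor_eq
  by (rule equivpI) (auto simp: reflp_def symp_def transp_def intro: tensor_eq.intros)

instantiation alg_tensor :: (complex_vector, complex_vector) complex_vector
begin

lift_definition zero_alg_tensor :: "('a, 'b) alg_tensor" is "{#}" .
lift_definition plus_alg_tensor :: "('a, 'b) alg_tensor \<Rightarrow> ('a, 'b) alg_tensor \<Rightarrow> ('a, 'b) alg_tensor"
  is "(+)" by (rule tensor_eq_add)
lift_definition scaleC_alg_tensor :: "complex \<Rightarrow> ('a, 'b) alg_tensor \<Rightarrow> ('a, 'b) alg_tensor"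
  is scale_formal by (rule tensor_eq_scale)
definition scaleR_alg_tensor :: "real \<Rightarrow> ('a, 'b) alg_tensor \<Rightarrow> ('a, 'b) alg_tensor"
  where "scaleR_alg_tensor r u = complex_of_real r *\<^sub>C u"
definition uminus_alg_tensor :: "('a, 'b) alg_tensor \<Rightarrow> ('a, 'b) alg_tensor"
  where "uminus_alg_tensor u = (- 1) *\<^sub>C u"
definition minus_alg_tensor :: "('a, 'b) alg_tensor \<Rightarrow> ('a, 'b) alg_tensor \<Rightarrow> ('a, 'b) alg_tensor"
  where "minus_alg_tensor u v = u + - v"

instance
proof
  fix u v w :: "('a, 'b) alg_tensor" and r s :: real and c d :: complex
  have add_right: "c *\<^sub>C (u + v) = c *\<^sub>C u + c *\<^sub>C v" for c and u v :: "('a, 'b) alg_tensor"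
    by transfer (simp add: tensor_eq.refl)
  have add_left: "(c + d) *\<^sub>C u = c *\<^sub>C u + d *\<^sub>C u" for c d and u :: "('a, 'b) alg_tensor"
    by transfer (rule tensor_eq_scale_add)
  have scale: "c *\<^sub>C d *\<^sub>C u = (c * d) *\<^sub>C u" for c d and u :: "('a, 'b) alg_tensor"
    by transfer (simp add: tensor_eq.refl)
  have one: "1 *\<^sub>C u = u" for u :: "('a, 'b) alg_tensor"
    by transfer (simp add: tensor_eq.refl)
  have zero: "0 *\<^sub>C u = 0" for u :: "('a, 'b) alg_tensor"
    by transfer (rule tensor_eq_scale_zero)
  show "u + v + w = u + (v + w)" by transfer (simp add: add.assoc tensor_eq.refl)
  show "u + v = v + u" by transfer (simp add: add.commute tensor_eq.refl)
  show "0 + u = u" by transfer (simp add: tensor_eq.refl)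
  show "- u + u = 0" using add_left[of "-1" 1 u] by (simp add: uminus_alg_tensor_def one zero)
  show "u - v = u + - v" by (rule minus_alg_tensor_def)
  show "r *\<^sub>R (u + v) = r *\<^sub>R u + r *\<^sub>R v" by (simp add: scaleR_alg_tensor_def add_right)
  show "(r + s) *\<^sub>R u = r *\<^sub>R u + s *\<^sub>R u" by (simp add: scaleR_alg_tensor_def add_left)
  show "r *\<^sub>R s *\<^sub>R u = (r * s) *\<^sub>R u" by (simp add: scaleR_alg_tensor_def scale)
  show "1 *\<^sub>R u = u" by (simp add: scaleR_alg_tensor_def one)
  show "c *\<^sub>C (u + v) = c *\<^sub>C u + c *\<^sub>C v" by (rule add_right)
  show "(c + d) *\<^sub>C u = c *\<^sub>C u + d *\<^sub>C u" by (rule add_left)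
  show "c *\<^sub>C d *\<^sub>C u = (c * d) *\<^sub>C u" by (rule scale)
  show "1 *\<^sub>C u = u" by (rule one)
  show "r *\<^sub>R u = complex_of_real r *\<^sub>C u" by (rule scaleR_alg_tensor_def)
qed

end

lift_definition atensor :: "'a::complex_vector \<Rightarrow> 'b::complex_vector \<Rightarrow> ('a, 'b) alg_tensor"
  is "\<lambda>a b. {#(a, b)#}" .

lemma formal_pair: "{#x#} + {#y#} = {#x, y#}"
  by simp

lemma atensor_simps:
  "atensor (a + a') b = atensor a b + atensor a' b"
  "atensor a (b + b') = atensor a b + atensor a b'"
  "atensor (c *\<^sub>C a) b = c *\<^sub>C atensor a b"
  "atensor a (c *\<^sub>C b) = c *\<^sub>C atensor a b"
proof -
  show "atensor (a + a') b = atensor a b + atensor a' b"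
    by transfer (subst formal_pair, rule tensor_eq.add_left)
  show "atensor a (b + b') = atensor a b + atensor a b'"
    by transfer (subst formal_pair, rule tensor_eq.add_right)
  show "atensor (c *\<^sub>C a) b = c *\<^sub>C atensor a b"
    by transfer (simp add: tensor_eq.refl)
  show "atensor a (c *\<^sub>C b) = c *\<^sub>C atensor a b"
    by transfer (simp add: tensor_eq.scale tensor_eq.sym)
qed

definition formal_sum :: "('a \<times> 'b) multiset \<Rightarrow> ('a::complex_vector, 'b::complex_vector) alg_tensor"
  where "formal_sum M = (\<Sum>(a, b)\<in>#M. atensor a b)"

lemma formal_sum_simps [simp]:
  "formal_sum {#} = 0"
  "formal_sum (add_mset (a, b) M) = atensor a b + formal_sum M"
  "formal_sum (M + N) = formal_sum M + formal_sum N"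
  by (simp_all add: formal_sum_def)

lemma formal_sum_abs: "formal_sum M = abs_alg_tensor M"
proof (induction M)
  case empty
  show ?case by (simp add: zero_alg_tensor.abs_eq)
next
  case (add x M)
  obtain a b where x: "x = (a, b)" by (cases x)
  show ?case by (simp add: x add atensor.abs_eq plus_alg_tensor.abs_eq)
qed

lemma formal_sum_eq_iff: "formal_sum M = formal_sum N \<longleftrightarrow> tensor_eq M N"
  by (simp add: formal_sum_abs alg_tensor.abs_eq_iff)

lemma formal_sum_surj: "\<exists>M. formal_sum M = u"
  by (metis formal_sum_abs Quotient_alg_tensor Quotient_abs_rep)

lemma formal_sum_scale: "formal_sum (scale_formal c M) = c *\<^sub>C formal_sum M"
  by (induction M) (auto simp: atensor_simps scaleC_add_right)

(* The projective norm: infimum over all representations of u as a finite sum of elementary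
   tensors. *)
definition proj_norm ::
    "('a::complex_normed_vector, 'b::complex_normed_vector) alg_tensor \<Rightarrow> real"
  where "proj_norm u = Inf {\<Sum>(a, b)\<in>#M. norm a * norm b | M. u = (\<Sum>(a, b)\<in>#M. atensor a b)}"

definition formal_norm :: "('a::complex_normed_vector \<times> 'b::complex_normed_vector) multiset \<Rightarrow> real"
  where "formal_norm M = (\<Sum>(a, b)\<in>#M. norm a * norm b)"

lemma formal_norm_simps [simp]:
  "formal_norm {#} = 0"
  "formal_norm (add_mset (a, b) M) = norm a * norm b + formal_norm M"
  "formal_norm (M + N) = formal_norm M + formal_norm N"
  by (simp_all add: formal_norm_def)

lemma formal_norm_nonneg: "0 \<le> formal_norm M"
  by (induction M) auto

lemma formal_norm_scale: "formal_norm (scale_formal c M) = cmod c * formal_norm M"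
  by (induction M) (auto simp: algebra_simps)

lemma proj_norm_alt: "proj_norm u = Inf {formal_norm M | M. formal_sum M = u}"
  unfolding proj_norm_def formal_norm_def formal_sum_def by (rule arg_cong[of _ _ Inf]) auto

lemma proj_norm_le: "formal_sum M = u \<Longrightarrow> proj_norm u \<le> formal_norm M"
  unfolding proj_norm_alt
  by (rule cInf_lower) (auto intro!: bdd_belowI[of _ 0] formal_norm_nonneg)

lemma proj_norm_approx:
  assumes "proj_norm u < e"
  obtains M where "formal_sum M = u" "formal_norm M < e"
proof -
  have "{formal_norm M | M. formal_sum M = u} \<noteq> {}" using formal_sum_surj[of u] by auto
  from cInf_lessD[OF this] assms show ?thesis
    unfolding proj_norm_alt using that by auto
qed

lemma proj_norm_nonneg: "0 \<le> proj_norm u"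
  unfolding proj_norm_alt using formal_sum_surj[of u]
  by (intro cInf_greatest) (auto intro: formal_norm_nonneg)

lemma proj_norm_zero [simp]:
  "proj_norm (0 :: ('a::complex_normed_vector, 'b::complex_normed_vector) alg_tensor) = 0"
  using proj_norm_le[of "{#}" "0 :: ('a, 'b) alg_tensor"] proj_norm_nonneg[of "0 :: ('a, 'b) alg_tensor"]
  by simp

lemma proj_norm_triangle: "proj_norm (u + v) \<le> proj_norm u + proj_norm v"
proof (rule field_le_epsilon)
  fix e :: real assume e: "0 < e"
  obtain M where M: "formal_sum M = u" "formal_norm M < proj_norm u + e / 2"
    using proj_norm_approx[of u "proj_norm u + e / 2"] e by auto
  obtain N where N: "formal_sum N = v" "formal_norm N < proj_norm v + e / 2"
    using proj_norm_approx[of v "proj_norm v + e / 2"] e by auto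
  have "proj_norm (u + v) \<le> formal_norm (M + N)" by (rule proj_norm_le) (simp add: M N)
  then show "proj_norm (u + v) \<le> proj_norm u + proj_norm v + e" using M N by simp
qed

lemma proj_norm_scale_le: "proj_norm (c *\<^sub>C u) \<le> cmod c * proj_norm u"
proof (rule field_le_epsilon)
  fix e :: real assume e: "0 < e"
  define d where "d = e / (cmod c + 1)"
  have cpos: "0 < cmod c + 1" by (smt (verit) norm_ge_zero)
  then have d: "0 < d" using e by (simp add: d_def)
  obtain M where M: "formal_sum M = u" "formal_norm M < proj_norm u + d"
    using proj_norm_approx[of u "proj_norm u + d"] d by auto
  have "proj_norm (c *\<^sub>C u) \<le> formal_norm (scale_formal c M)"
    by (rule proj_norm_le) (simp add: M formal_sum_scale)
  also have "\<dots> \<le> cmod c * (proj_norm u + d)"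
    using M(2) by (simp add: formal_norm_scale mult_left_mono)
  also have "\<dots> \<le> cmod c * proj_norm u + e"
  proof -
    have "cmod c * d \<le> (cmod c + 1) * d" using d by simp
    also have "\<dots> = e" using cpos by (simp add: d_def)
    finally show ?thesis by (simp add: distrib_left)
  qed
  finally show "proj_norm (c *\<^sub>C u) \<le> cmod c * proj_norm u + e" .
qed

lemma proj_norm_scale: "proj_norm (c *\<^sub>C u) = cmod c * proj_norm u"
proof (cases "c = 0")
  case False
  have "proj_norm u \<le> cmod (inverse c) * proj_norm (c *\<^sub>C u)"
    using proj_norm_scale_le[of "inverse c" "c *\<^sub>C u"] False by simp
  then have "cmod c * proj_norm u \<le> proj_norm (c *\<^sub>C u)"
    using False by (simp add: norm_inverse norm_divide field_simps)
  with proj_norm_scale_le[of c u] show ?thesis by simp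
qed simp

lemma proj_norm_minus [simp]: "proj_norm (- u) = proj_norm u"
  using proj_norm_scale[of "-1" u] by (simp add: scaleC_minus_one)

lemma proj_norm_commute: "proj_norm (u - v) = proj_norm (v - u)"
  using proj_norm_minus[of "u - v"] by simp

lemma proj_norm_diff_triangle: "proj_norm (u - w) \<le> proj_norm (u - v) + proj_norm (v - w)"
  using proj_norm_triangle[of "u - v" "v - w"] by simp

lemma proj_norm_diff_abs: "\<bar>proj_norm u - proj_norm v\<bar> \<le> proj_norm (u - v)"
  using proj_norm_triangle[of "u - v" v] proj_norm_triangle[of "v - u" u]
  by (simp add: proj_norm_commute[of v u] abs_le_iff)

(* The projective tensor product is the completion of the algebraic one: Cauchy sequences for
   proj_norm modulo null sequences. That proj_norm is definite is not needed for this
   construction, which would divide out any kernel. *)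
definition proj_Cauchy ::
    "(nat \<Rightarrow> ('a::complex_normed_vector, 'b::complex_normed_vector) alg_tensor) \<Rightarrow> bool"
  where "proj_Cauchy X \<longleftrightarrow> (\<forall>e>0. \<exists>N. \<forall>m\<ge>N. \<forall>n\<ge>N. proj_norm (X m - X n) < e)"

definition proj_rel ::
    "(nat \<Rightarrow> ('a::complex_normed_vector, 'b::complex_normed_vector) alg_tensor) \<Rightarrow> (nat \<Rightarrow> ('a, 'b) alg_tensor) \<Rightarrow> bool"
  where "proj_rel X Y \<longleftrightarrow> proj_Cauchy X \<and> proj_Cauchy Y \<and> (\<lambda>n. proj_norm (X n - Y n)) \<longlonglongrightarrow> 0"

lemma proj_Cauchy_const: "proj_Cauchy (\<lambda>_. u)"
  by (simp add: proj_Cauchy_def)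

lemma proj_null_le:
  assumes "Y \<longlonglongrightarrow> 0" "\<And>n. proj_norm (X n) \<le> Y n"
  shows "(\<lambda>n. proj_norm (X n)) \<longlonglongrightarrow> 0"
  by (rule tendsto_sandwich[OF _ _ tendsto_const assms(1)])
     (auto simp: assms(2) proj_norm_nonneg)

lemma proj_Cauchy_add:
  assumes "proj_Cauchy X" "proj_Cauchy Y" shows "proj_Cauchy (\<lambda>n. X n + Y n)"
  unfolding proj_Cauchy_def
proof (intro allI impI)
  fix e :: real assume "0 < e"
  then have e: "0 < e / 2" by simp
  obtain M where M: "\<And>m n. m \<ge> M \<Longrightarrow> n \<ge> M \<Longrightarrow> proj_norm (X m - X n) < e / 2"
    using assms(1) e unfolding proj_Cauchy_def by blast
  obtain N where N: "\<And>m n. m \<ge> N \<Longrightarrow> n \<ge> N \<Longrightarrow> proj_norm (Y m - Y n) < e / 2"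
    using assms(2) e unfolding proj_Cauchy_def by blast
  have "proj_norm (X m + Y m - (X n + Y n)) < e" if "m \<ge> max M N" "n \<ge> max M N" for m n
    using M[of m n] N[of m n] that proj_norm_triangle[of "X m - X n" "Y m - Y n"]
    by (simp add: algebra_simps)
  then show "\<exists>N. \<forall>m\<ge>N. \<forall>n\<ge>N. proj_norm (X m + Y m - (X n + Y n)) < e" by blast
qed

lemma proj_Cauchy_scale:
  assumes "proj_Cauchy X" shows "proj_Cauchy (\<lambda>n. c *\<^sub>C X n)"
  unfolding proj_Cauchy_def
proof (intro allI impI)
  fix e :: real assume e: "0 < e"
  have cpos: "0 < cmod c + 1" by (smt (verit) norm_ge_zero)
  then have "0 < e / (cmod c + 1)" using e by simp
  then obtain N where N: "\<And>m n. m \<ge> N \<Longrightarrow> n \<ge> N \<Longrightarrow> proj_norm (X m - X n) < e / (cmod c + 1)"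
    using assms unfolding proj_Cauchy_def by blast
  have "proj_norm (c *\<^sub>C X m - c *\<^sub>C X n) < e" if "m \<ge> N" "n \<ge> N" for m n
  proof -
    have "cmod c * proj_norm (X m - X n) \<le> (cmod c + 1) * proj_norm (X m - X n)"
      by (simp add: mult_right_mono proj_norm_nonneg)
    also have "\<dots> < e" using N[OF that] cpos by (simp add: field_simps)
    finally show ?thesis by (simp add: proj_norm_scale flip: scaleC_diff_right)
  qed
  then show "\<exists>N. \<forall>m\<ge>N. \<forall>n\<ge>N. proj_norm (c *\<^sub>C X m - c *\<^sub>C X n) < e" by blast
qed

lemma proj_rel_add:
  assumes "proj_rel X X'" "proj_rel Y Y'"
  shows "proj_rel (\<lambda>n. X n + Y n) (\<lambda>n. X' n + Y' n)"
proof -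
  have "(\<lambda>n. proj_norm (X n + Y n - (X' n + Y' n))) \<longlonglongrightarrow> 0"
  proof (rule proj_null_le)
    show "(\<lambda>n. proj_norm (X n - X' n) + proj_norm (Y n - Y' n)) \<longlonglongrightarrow> 0"
      using assms tendsto_add[of _ 0 _ _ 0] unfolding proj_rel_def by fastforce
  next
    show "proj_norm (X n + Y n - (X' n + Y' n)) \<le> proj_norm (X n - X' n) + proj_norm (Y n - Y' n)" for n
      using proj_norm_triangle[of "X n - X' n" "Y n - Y' n"] by (simp add: algebra_simps)
  qed
  then show ?thesis using assms by (auto simp: proj_rel_def proj_Cauchy_add)
qed

lemma proj_rel_scale:
  assumes "proj_rel X X'" shows "proj_rel (\<lambda>n. c *\<^sub>C X n) (\<lambda>n. c *\<^sub>C X' n)"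
proof -
  have "(\<lambda>n. cmod c * proj_norm (X n - X' n)) \<longlonglongrightarrow> 0"
    using assms by (simp add: proj_rel_def tendsto_mult_right_zero)
  then show ?thesis using assms
    by (simp add: proj_rel_def proj_Cauchy_scale proj_norm_scale flip: scaleC_diff_right)
qed

lemma part_equivp_proj_rel:
  "part_equivp (proj_rel ::
    (nat \<Rightarrow> ('a::complex_normed_vector, 'b::complex_normed_vector) alg_tensor) \<Rightarrow> _)"
proof (rule part_equivpI)
  show "\<exists>X. proj_rel X (X :: nat \<Rightarrow> ('a, 'b) alg_tensor)"
    by (rule exI[of _ "\<lambda>_. 0"]) (simp add: proj_rel_def proj_Cauchy_const)
  show "symp (proj_rel :: (nat \<Rightarrow> ('a, 'b) alg_tensor) \<Rightarrow> _)"
    by (auto simp: symp_def proj_rel_def proj_norm_commute)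
  show "transp (proj_rel :: (nat \<Rightarrow> ('a, 'b) alg_tensor) \<Rightarrow> _)"
  proof (rule transpI)
    fix X Y Z :: "nat \<Rightarrow> ('a, 'b) alg_tensor"
    assume *: "proj_rel X Y" "proj_rel Y Z"
    have "(\<lambda>n. proj_norm (X n - Z n)) \<longlonglongrightarrow> 0"
    proof (rule proj_null_le)
      show "(\<lambda>n. proj_norm (X n - Y n) + proj_norm (Y n - Z n)) \<longlonglongrightarrow> 0"
        using * tendsto_add[of _ 0 _ _ 0] unfolding proj_rel_def by fastforce
    qed (rule proj_norm_diff_triangle)
    then show "proj_rel X Z" using * by (auto simp: proj_rel_def)
  qed
qed

quotient_type (overloaded) ('a, 'b) proj_tensor =
  "nat \<Rightarrow> ('a::complex_normed_vector, 'b::complex_normed_vector) alg_tensor" / partial: proj_rel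
  by (rule part_equivp_proj_rel)

lemma proj_Cauchy_norm:
  assumes "proj_Cauchy X" shows "convergent (\<lambda>n. proj_norm (X n))"
proof -
  have "Cauchy (\<lambda>n. proj_norm (X n))"
    unfolding Cauchy_def dist_real_def
  proof (intro allI impI)
    fix e :: real assume "0 < e"
    then obtain N where "\<And>m n. m \<ge> N \<Longrightarrow> n \<ge> N \<Longrightarrow> proj_norm (X m - X n) < e"
      using assms unfolding proj_Cauchy_def by blast
    then show "\<exists>M. \<forall>m\<ge>M. \<forall>n\<ge>M. \<bar>proj_norm (X m) - proj_norm (X n)\<bar> < e"
      by (meson proj_norm_diff_abs order_le_less_trans)
  qed
  then show ?thesis by (simp add: Cauchy_convergent_iff)
qed

lemma proj_Cauchy_lim:
  "proj_Cauchy X \<Longrightarrow> (\<lambda>n. proj_norm (X n)) \<longlonglongrightarrow> lim (\<lambda>n. proj_norm (X n))"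
  using proj_Cauchy_norm convergent_LIMSEQ_iff by blast

instantiation proj_tensor :: (complex_normed_vector, complex_normed_vector) complex_normed_vector
begin

lift_definition zero_proj_tensor :: "('a, 'b) proj_tensor" is "\<lambda>_. 0"
  by (simp add: proj_rel_def proj_Cauchy_const)
lift_definition plus_proj_tensor :: "('a, 'b) proj_tensor \<Rightarrow> ('a, 'b) proj_tensor \<Rightarrow> ('a, 'b) proj_tensor"
  is "\<lambda>X Y n. X n + Y n" by (rule proj_rel_add)
lift_definition scaleC_proj_tensor :: "complex \<Rightarrow> ('a, 'b) proj_tensor \<Rightarrow> ('a, 'b) proj_tensor"
  is "\<lambda>c X n. c *\<^sub>C X n" by (rule proj_rel_scale)
lift_definition norm_proj_tensor :: "('a, 'b) proj_tensor \<Rightarrow> real"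
  is "\<lambda>X. lim (\<lambda>n. proj_norm (X n))"
proof -
  fix X Y :: "nat \<Rightarrow> ('a, 'b) alg_tensor"
  assume *: "proj_rel X Y"
  have "(\<lambda>n. proj_norm (X n) - proj_norm (Y n)) \<longlonglongrightarrow> 0"
  proof (rule Lim_null_comparison)
    show "(\<lambda>n. proj_norm (X n - Y n)) \<longlonglongrightarrow> 0" using * by (simp add: proj_rel_def)
  qed (simp add: proj_norm_diff_abs)
  moreover have "(\<lambda>n. proj_norm (X n) - proj_norm (Y n)) \<longlonglongrightarrow>
      lim (\<lambda>n. proj_norm (X n)) - lim (\<lambda>n. proj_norm (Y n))"
    using * by (intro tendsto_diff proj_Cauchy_lim) (auto simp: proj_rel_def)
  ultimately show "lim (\<lambda>n. proj_norm (X n)) = lim (\<lambda>n. proj_norm (Y n))"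
    using LIMSEQ_unique by fastforce
qed
definition scaleR_proj_tensor :: "real \<Rightarrow> ('a, 'b) proj_tensor \<Rightarrow> ('a, 'b) proj_tensor"
  where "scaleR_proj_tensor r u = complex_of_real r *\<^sub>C u"
definition uminus_proj_tensor :: "('a, 'b) proj_tensor \<Rightarrow> ('a, 'b) proj_tensor"
  where "uminus_proj_tensor u = (- 1) *\<^sub>C u"
definition minus_proj_tensor :: "('a, 'b) proj_tensor \<Rightarrow> ('a, 'b) proj_tensor \<Rightarrow> ('a, 'b) proj_tensor"
  where "minus_proj_tensor u v = u + - v"
definition dist_proj_tensor :: "('a, 'b) proj_tensor \<Rightarrow> ('a, 'b) proj_tensor \<Rightarrow> real"
  where "dist_proj_tensor u v = norm (u - v)"
definition sgn_proj_tensor :: "('a, 'b) proj_tensor \<Rightarrow> ('a, 'b) proj_tensor"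
  where "sgn_proj_tensor u = inverse (norm u) *\<^sub>R u"
definition uniformity_proj_tensor :: "(('a, 'b) proj_tensor \<times> ('a, 'b) proj_tensor) filter"
  where "uniformity_proj_tensor = (INF e\<in>{0<..}. principal {(x, y). dist x y < e})"
definition open_proj_tensor :: "('a, 'b) proj_tensor set \<Rightarrow> bool"
  where "open_proj_tensor U \<longleftrightarrow> (\<forall>x\<in>U. \<forall>\<^sub>F (x', y) in uniformity. x' = x \<longrightarrow> y \<in> U)"

instance
proof
  fix u v w :: "('a, 'b) proj_tensor" and r s :: real and c d :: complex
  have add_right: "c *\<^sub>C (u + v) = c *\<^sub>C u + c *\<^sub>C v" for c and u v :: "('a, 'b) proj_tensor"
    by transfer (simp add: scaleC_add_right proj_rel_def proj_Cauchy_add proj_Cauchy_scale)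
  have add_left: "(c + d) *\<^sub>C u = c *\<^sub>C u + d *\<^sub>C u" for c d and u :: "('a, 'b) proj_tensor"
    by transfer (simp add: scaleC_add_left proj_rel_def proj_Cauchy_add proj_Cauchy_scale)
  have scale: "c *\<^sub>C d *\<^sub>C u = (c * d) *\<^sub>C u" for c d and u :: "('a, 'b) proj_tensor"
    by transfer (simp add: proj_rel_def proj_Cauchy_scale)
  have one: "1 *\<^sub>C u = u" for u :: "('a, 'b) proj_tensor"
    by transfer simp
  have zero: "0 *\<^sub>C u = 0" for u :: "('a, 'b) proj_tensor"
    by transfer (simp add: proj_rel_def proj_Cauchy_const)
  show "u + v + w = u + (v + w)"
    by transfer (simp add: add.assoc proj_rel_def proj_Cauchy_add)
  show "u + v = v + u" by transfer (simp add: add.commute proj_rel_def proj_Cauchy_add)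
  show "0 + u = u" by transfer simp
  show "- u + u = 0" using add_left[of "-1" 1 u] by (simp add: uminus_proj_tensor_def one zero)
  show "u - v = u + - v" by (rule minus_proj_tensor_def)
  show "r *\<^sub>R (u + v) = r *\<^sub>R u + r *\<^sub>R v" by (simp add: scaleR_proj_tensor_def add_right)
  show "(r + s) *\<^sub>R u = r *\<^sub>R u + s *\<^sub>R u" by (simp add: scaleR_proj_tensor_def add_left)
  show "r *\<^sub>R s *\<^sub>R u = (r * s) *\<^sub>R u" by (simp add: scaleR_proj_tensor_def scale)
  show "1 *\<^sub>R u = u" by (simp add: scaleR_proj_tensor_def one)
  show "c *\<^sub>C (u + v) = c *\<^sub>C u + c *\<^sub>C v" by (rule add_right)
  show "(c + d) *\<^sub>C u = c *\<^sub>C u + d *\<^sub>C u" by (rule add_left)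
  show "c *\<^sub>C d *\<^sub>C u = (c * d) *\<^sub>C u" by (rule scale)
  show "1 *\<^sub>C u = u" by (rule one)
  show "r *\<^sub>R u = complex_of_real r *\<^sub>C u" by (rule scaleR_proj_tensor_def)
  show "dist u v = norm (u - v)" by (rule dist_proj_tensor_def)
  show "sgn u = inverse (norm u) *\<^sub>R u" by (rule sgn_proj_tensor_def)
  show "uniformity = (INF e\<in>{0<..}. principal {(x, y :: ('a, 'b) proj_tensor). dist x y < e})"
    by (rule uniformity_proj_tensor_def)
  show "open U = (\<forall>x\<in>U. \<forall>\<^sub>F (x', y) in uniformity. x' = x \<longrightarrow> y \<in> U)" for U :: "('a, 'b) proj_tensor set"
    by (rule open_proj_tensor_def)
  show norm_scale: "norm (c *\<^sub>C u) = cmod c * norm u" for c and u :: "('a, 'b) proj_tensor"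
  proof transfer
    fix c and X :: "nat \<Rightarrow> ('a, 'b) alg_tensor"
    assume "proj_rel X X"
    then have "(\<lambda>n. cmod c * proj_norm (X n)) \<longlonglongrightarrow> cmod c * lim (\<lambda>n. proj_norm (X n))"
      by (intro tendsto_mult tendsto_const proj_Cauchy_lim) (simp add: proj_rel_def)
    then show "lim (\<lambda>n. proj_norm (c *\<^sub>C X n)) = cmod c * lim (\<lambda>n. proj_norm (X n))"
      by (simp add: proj_norm_scale limI)
  qed
  show "norm (r *\<^sub>R u) = \<bar>r\<bar> * norm u" by (simp add: scaleR_proj_tensor_def norm_scale)
  show "(norm u = 0) = (u = 0)"
  proof transfer
    fix X :: "nat \<Rightarrow> ('a, 'b) alg_tensor"
    assume "proj_rel X X"
    then have C: "proj_Cauchy X" by (simp add: proj_rel_def)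
    show "(lim (\<lambda>n. proj_norm (X n)) = 0) = proj_rel X (\<lambda>_. 0)"
      using proj_Cauchy_lim[OF C] C by (auto simp: proj_rel_def proj_Cauchy_const intro: limI)
  qed
  show "norm (u + v) \<le> norm u + norm v"
  proof transfer
    fix X Y :: "nat \<Rightarrow> ('a, 'b) alg_tensor"
    assume "proj_rel X X" "proj_rel Y Y"
    then have C: "proj_Cauchy X" "proj_Cauchy Y" by (auto simp: proj_rel_def)
    show "lim (\<lambda>n. proj_norm (X n + Y n)) \<le> lim (\<lambda>n. proj_norm (X n)) + lim (\<lambda>n. proj_norm (Y n))"
      by (rule LIMSEQ_le[OF proj_Cauchy_lim[OF proj_Cauchy_add[OF C]]
            tendsto_add[OF proj_Cauchy_lim[OF C(1)] proj_Cauchy_lim[OF C(2)]]])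
         (auto intro: proj_norm_triangle)
  qed
qed

end

definition proj_embed ::
    "('a::complex_normed_vector, 'b::complex_normed_vector) alg_tensor \<Rightarrow> ('a, 'b) proj_tensor"
  where "proj_embed u = abs_proj_tensor (\<lambda>_. u)"

lemma proj_rel_const: "proj_rel (\<lambda>_. u) (\<lambda>_. u)"
  by (simp add: proj_rel_def proj_Cauchy_const)

lemma proj_embed_add: "proj_embed (u + v) = proj_embed u + proj_embed v"
  by (simp add: proj_embed_def plus_proj_tensor.abs_eq proj_rel_const)

lemma proj_embed_scale: "proj_embed (c *\<^sub>C u) = c *\<^sub>C proj_embed u"
  by (simp add: proj_embed_def scaleC_proj_tensor.abs_eq proj_rel_const)

lemma proj_embed_diff: "proj_embed (u - v) = proj_embed u - proj_embed v"
  using proj_embed_add[of u "-v"] proj_embed_scale[of "-1" v] by (simp add: scaleC_minus_one)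

lemma proj_embed_zero: "proj_embed 0 = 0"
  using proj_embed_diff[of 0 0] by simp

lemma norm_proj_embed: "norm (proj_embed u) = proj_norm u"
  by (simp add: proj_embed_def norm_proj_tensor.abs_eq proj_rel_const limI)

lemma proj_embed_tendsto:
  assumes "proj_Cauchy X"
  shows "(\<lambda>n. proj_embed (X n)) \<longlonglongrightarrow> abs_proj_tensor X"
proof (rule LIMSEQ_I)
  fix e :: real assume "0 < e"
  then have e: "0 < e / 2" by simp
  obtain N where N: "\<And>m n. m \<ge> N \<Longrightarrow> n \<ge> N \<Longrightarrow> proj_norm (X m - X n) < e / 2"
    using assms e unfolding proj_Cauchy_def by blast
  have "norm (proj_embed (X m) - abs_proj_tensor X) < e" if m: "m \<ge> N" for m
  proof -
    have rel: "proj_rel X X" using assms by (simp add: proj_rel_def)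
    have rel': "proj_rel (\<lambda>n. - 1 *\<^sub>C X n) (\<lambda>n. - 1 *\<^sub>C X n)"
      by (rule proj_rel_scale[OF rel])
    have relc: "proj_rel (\<lambda>_. X m) (\<lambda>_. X m)" by (simp add: proj_rel_def proj_Cauchy_const)
    have "proj_embed (X m) - abs_proj_tensor X = abs_proj_tensor (\<lambda>n. X m - X n)"
      using plus_proj_tensor.abs_eq[OF relc rel'] scaleC_proj_tensor.abs_eq[OF rel, of "-1"]
      unfolding proj_embed_def scaleC_minus_one diff_conv_add_uminus by simp
    moreover have C: "proj_Cauchy (\<lambda>n. X m - X n)"
      using proj_Cauchy_add[OF proj_Cauchy_const[of "X m"] proj_Cauchy_scale[OF assms, of "-1"]]
      by (simp add: scaleC_minus_one)
    ultimately have "norm (proj_embed (X m) - abs_proj_tensor X) = lim (\<lambda>n. proj_norm (X m - X n))"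
      by (simp add: norm_proj_tensor.abs_eq proj_rel_def)
    also have "\<dots> \<le> e / 2"
      by (rule LIMSEQ_le_const2[OF proj_Cauchy_lim[OF C]]) (use N[OF m] in \<open>auto intro: less_imp_le\<close>)
    finally show ?thesis using \<open>0 < e\<close> by simp
  qed
  then show "\<exists>no. \<forall>n\<ge>no. norm (proj_embed (X n) - abs_proj_tensor X) < e" by blast
qed

lemma rep_proj_tensor:
  "proj_rel (rep_proj_tensor T) (rep_proj_tensor T)" "abs_proj_tensor (rep_proj_tensor T) = T"
  by (rule Quotient_rep_reflp[OF Quotient_proj_tensor], rule Quotient_abs_rep[OF Quotient_proj_tensor])

lemma proj_tensor_cases:
  obtains X where "proj_Cauchy X" "T = abs_proj_tensor X"
  using rep_proj_tensor(1)[of T] that[OF _ rep_proj_tensor(2)[of T, symmetric]]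
  unfolding proj_rel_def by blast

lemma proj_embed_dense:
  assumes "0 < e" obtains u where "norm (proj_embed u - T) < e"
proof -
  obtain X where X: "proj_Cauchy X" "T = abs_proj_tensor X" by (rule proj_tensor_cases)
  from LIMSEQ_D[OF proj_embed_tendsto[OF X(1)] assms] show ?thesis using that X(2) by blast
qed

instance proj_tensor :: (complex_normed_vector, complex_normed_vector) complex_banach
proof
  fix T :: "nat \<Rightarrow> ('a, 'b) proj_tensor"
  assume T: "Cauchy T"
  have "\<exists>u. norm (proj_embed u - T n) < inverse (real (Suc n))" for n
    by (rule proj_embed_dense[of "inverse (real (Suc n))" "T n"]) auto
  then obtain u where u: "\<And>n. norm (proj_embed (u n) - T n) < inverse (real (Suc n))" by metis
  have lim0: "(\<lambda>n. proj_embed (u n) - T n) \<longlonglongrightarrow> 0"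
    by (rule Lim_null_comparison[OF _ LIMSEQ_inverse_real_of_nat])
       (rule always_eventually, rule allI, rule less_imp_le, rule u)
  have "Cauchy (\<lambda>n. proj_embed (u n))"
    unfolding Cauchy_iff
  proof (intro allI impI)
    fix e :: real assume "0 < e"
    then have e: "0 < e / 3" by simp
    obtain M where M: "\<And>n. n \<ge> M \<Longrightarrow> norm (proj_embed (u n) - T n) < e / 3"
      using LIMSEQ_D[OF lim0 e] by auto
    obtain N where N: "\<And>m n. m \<ge> N \<Longrightarrow> n \<ge> N \<Longrightarrow> norm (T m - T n) < e / 3"
      using T e unfolding Cauchy_iff by blast
    have "norm (proj_embed (u m) - proj_embed (u n)) < e" if "m \<ge> max M N" "n \<ge> max M N" for m n
    proof -
      have "proj_embed (u m) - proj_embed (u n) =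
          (proj_embed (u m) - T m) + (T m - T n) - (proj_embed (u n) - T n)" by simp
      also have "norm \<dots> \<le> norm (proj_embed (u m) - T m) + norm (T m - T n) + norm (proj_embed (u n) - T n)"
        by (meson norm_triangle_ineq norm_triangle_ineq4 add_right_mono order_trans)
      finally show ?thesis using M[of m] M[of n] N[of m n] that by simp
    qed
    then show "\<exists>M. \<forall>m\<ge>M. \<forall>n\<ge>M. norm (proj_embed (u m) - proj_embed (u n)) < e" by blast
  qed
  then have "proj_Cauchy u"
    by (simp add: Cauchy_iff proj_Cauchy_def norm_proj_embed flip: proj_embed_diff)
  from tendsto_diff[OF proj_embed_tendsto[OF this] lim0]
  show "convergent T" by (auto simp: convergent_def)
qed

definition tensor :: "'a::complex_normed_vector \<Rightarrow> 'b::complex_normed_vector \<Rightarrow> ('a, 'b) proj_tensor"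
  where "tensor a b = proj_embed (atensor a b)"

lemma tensor_simps:
  "tensor (a + a') b = tensor a b + tensor a' b"
  "tensor a (b + b') = tensor a b + tensor a b'"
  "tensor (c *\<^sub>C a) b = c *\<^sub>C tensor a b"
  "tensor a (c *\<^sub>C b) = c *\<^sub>C tensor a b"
  by (simp_all add: tensor_def atensor_simps proj_embed_add proj_embed_scale)

lemma norm_tensor_le: "norm (tensor a b) \<le> norm a * norm b"
  unfolding tensor_def norm_proj_embed using proj_norm_le[of "{#(a, b)#}" "atensor a b"] by simp

lemma bounded_clinear_eq_on_tensors:
  fixes f g :: "('a::complex_normed_vector, 'b::complex_normed_vector) proj_tensor \<Rightarrow> 'c::complex_normed_vector"
  assumes f: "bounded_clinear f" and g: "bounded_clinear g"
    and eq: "\<And>a b. f (tensor a b) = g (tensor a b)"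
  shows "f = g"
proof
  fix T :: "('a, 'b) proj_tensor"
  have lin: "linear f" "linear g"
    using f g by (auto simp: bounded_clinear_def intro: bounded_linear.linear)
  have formal: "f (proj_embed (formal_sum M)) = g (proj_embed (formal_sum M))" for M :: "('a \<times> 'b) multiset"
  proof (induction M)
    case empty
    then show ?case by (simp add: proj_embed_zero linear_0[OF lin(1)] linear_0[OF lin(2)])
  next
    case (add x M)
    then show ?case
      by (cases x) (simp add: proj_embed_add linear_add[OF lin(1)] linear_add[OF lin(2)]
          eq flip: tensor_def)
  qed
  obtain X where X: "proj_Cauchy X" "T = abs_proj_tensor X" by (rule proj_tensor_cases)
  have eqX: "f (proj_embed (X n)) = g (proj_embed (X n))" for n
  proof -
    obtain M where "formal_sum M = X n" using formal_sum_surj[of "X n"] by blast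
    then show ?thesis using formal[of M] by simp
  qed
  have blin: "bounded_linear f" "bounded_linear g" using f g by (auto simp: bounded_clinear_def)
  note lim = proj_embed_tendsto[OF X(1), folded X(2)]
  have "(\<lambda>n. f (proj_embed (X n))) \<longlonglongrightarrow> g T"
    unfolding eqX by (rule bounded_linear.tendsto[OF blin(2) lim])
  from LIMSEQ_unique[OF bounded_linear.tendsto[OF blin(1) lim] this] show "f T = g T" .
qed

definition formal_lift :: "('a \<Rightarrow> 'b \<Rightarrow> 'c::comm_monoid_add) \<Rightarrow> ('a \<times> 'b) multiset \<Rightarrow> 'c"
  where "formal_lift B M = (\<Sum>(a, b)\<in>#M. B a b)"

lemma formal_lift_simps [simp]:
  "formal_lift B {#} = 0"
  "formal_lift B (add_mset (a, b) M) = B a b + formal_lift B M"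
  "formal_lift B (M + N) = formal_lift B M + formal_lift B N"
  by (simp_all add: formal_lift_def)

(* The bounded linear map that sends each elementary tensor a (x) b to B a b; it exists and is
   unique for bounded bilinear B (lemma tensor_lift). *)
definition tensor_lift ::
    "('a::complex_normed_vector \<Rightarrow> 'b::complex_normed_vector \<Rightarrow> 'c::complex_banach) \<Rightarrow> ('a, 'b) proj_tensor \<Rightarrow> 'c"
  where "tensor_lift B = (THE f. bounded_clinear f \<and> (\<forall>a b. f (tensor a b) = B a b))"

lemma tensor_lift_exists:
  fixes B :: "'a::complex_normed_vector \<Rightarrow> 'b::complex_normed_vector \<Rightarrow> 'c::complex_banach"
  assumes B: "bounded_cbilinear B"
  shows "\<exists>f. bounded_clinear f \<and> (\<forall>a b. f (tensor a b) = B a b)"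
proof -
  interpret bounded_bilinear B using B by (simp add: bounded_cbilinear_def)
  have Bs: "B (c *\<^sub>C x) y = c *\<^sub>C B x y" "B x (c *\<^sub>C y) = c *\<^sub>C B x y" for c x y
    using B by (auto simp: bounded_cbilinear_def)
  obtain K where K: "0 < K" "\<And>a b. norm (B a b) \<le> norm a * norm b * K" using pos_bounded by blast
  have wd: "formal_lift B M = formal_lift B N" if "tensor_eq M N" for M N
    using that by induction (auto simp: add_left add_right Bs zero_left)
  define g where "g u = formal_lift B (SOME M. formal_sum M = u)" for u
  have g: "g (formal_sum M) = formal_lift B M" for M
  proof -
    have "formal_sum (SOME N. formal_sum N = formal_sum M) = formal_sum M"
      by (rule someI[of "\<lambda>N. formal_sum N = formal_sum M" M]) simp
    then show ?thesis unfolding g_def by (intro wd) (simp add: formal_sum_eq_iff)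
  qed
  have g_add: "g (u + v) = g u + g v" for u v
  proof -
    obtain M N where "u = formal_sum M" "v = formal_sum N"
      using formal_sum_surj[of u] formal_sum_surj[of v] by auto
    then show ?thesis using g[of "M + N"] g[of M] g[of N] by simp
  qed
  have lift_scale: "formal_lift B (scale_formal c M) = c *\<^sub>C formal_lift B M" for c M
    by (induction M) (auto simp: Bs scaleC_add_right)
  have g_scale: "g (c *\<^sub>C u) = c *\<^sub>C g u" for c u
  proof -
    obtain M where "u = formal_sum M" using formal_sum_surj[of u] by auto
    then show ?thesis
      using g[of "scale_formal c M"] g[of M] by (simp add: formal_sum_scale lift_scale)
  qed
  have g_diff: "g (u - v) = g u - g v" for u v
    using g_add[of u "-v"] g_scale[of "-1" v] by (simp add: scaleC_minus_one)
  have lift_bound: "norm (formal_lift B M) \<le> K * formal_norm M" for M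
  proof (induction M)
    case (add x M)
    obtain a b where x: "x = (a, b)" by (cases x)
    show ?case using norm_triangle_ineq[of "B a b" "formal_lift B M"] K(2)[of a b] add
      by (simp add: x algebra_simps)
  qed simp
  have g_bound: "norm (g u) \<le> K * proj_norm u" for u
  proof (rule field_le_epsilon)
    fix e :: real assume e: "0 < e"
    then obtain M where M: "formal_sum M = u" "formal_norm M < proj_norm u + e / K"
      using proj_norm_approx[of u "proj_norm u + e / K"] K(1) by auto
    have "norm (g u) \<le> K * formal_norm M" using lift_bound[of M] g[of M] M(1) by simp
    also have "\<dots> \<le> K * (proj_norm u + e / K)" using M(2) K(1) by simp
    also have "\<dots> = K * proj_norm u + e" using K(1) by (simp add: distrib_left)
    finally show "norm (g u) \<le> K * proj_norm u + e" .
  qed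
  have conv: "convergent (\<lambda>n. g (X n))" if X: "proj_Cauchy X" for X
  proof -
    have "Cauchy (\<lambda>n. g (X n))"
      unfolding Cauchy_iff
    proof (intro allI impI)
      fix e :: real assume "0 < e"
      then have "0 < e / K" using K(1) by simp
      then obtain N where N: "\<And>m n. m \<ge> N \<Longrightarrow> n \<ge> N \<Longrightarrow> proj_norm (X m - X n) < e / K"
        using X unfolding proj_Cauchy_def by blast
      have "norm (g (X m) - g (X n)) < e" if "m \<ge> N" "n \<ge> N" for m n
        using N[OF that] g_bound[of "X m - X n"] K(1) by (simp add: g_diff field_simps)
      then show "\<exists>M. \<forall>m\<ge>M. \<forall>n\<ge>M. norm (g (X m) - g (X n)) < e" by blast
    qed
    then show ?thesis by (simp add: Cauchy_convergent_iff)
  qed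
  define f where "f T = lim (\<lambda>n. g (rep_proj_tensor T n))" for T
  have f: "(\<lambda>n. g (X n)) \<longlonglongrightarrow> f (abs_proj_tensor X)" if X: "proj_Cauchy X" for X
  proof -
    let ?Y = "rep_proj_tensor (abs_proj_tensor X)"
    have Y: "proj_Cauchy ?Y" using rep_proj_tensor(1) by (auto simp: proj_rel_def)
    have XX: "proj_rel X X" using X by (simp add: proj_rel_def)
    have "proj_rel X ?Y"
      using Quotient_rel[OF Quotient_proj_tensor, of X ?Y] rep_proj_tensor(1)[of "abs_proj_tensor X"]
        rep_proj_tensor(2)[of "abs_proj_tensor X"] XX by simp
    then have "(\<lambda>n. K * proj_norm (X n - ?Y n)) \<longlonglongrightarrow> 0"
      by (simp add: proj_rel_def tendsto_mult_right_zero)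
    then have "(\<lambda>n. g (X n - ?Y n)) \<longlonglongrightarrow> 0"
      by (rule Lim_null_comparison[rotated]) (simp add: g_bound)
    moreover have "(\<lambda>n. g (?Y n)) \<longlonglongrightarrow> f (abs_proj_tensor X)"
      unfolding f_def using conv[OF Y] by (simp add: convergent_LIMSEQ_iff)
    ultimately have "(\<lambda>n. g (X n - ?Y n) + g (?Y n)) \<longlonglongrightarrow> 0 + f (abs_proj_tensor X)"
      by (rule tendsto_add)
    then show ?thesis by (simp add: g_diff)
  qed
  have f_embed: "f (proj_embed u) = g u" for u
  proof -
    have "(\<lambda>n::nat. g u) \<longlonglongrightarrow> f (proj_embed u)"
      unfolding proj_embed_def by (rule f[OF proj_Cauchy_const[of u]])
    from LIMSEQ_unique[OF this tendsto_const] show ?thesis .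
  qed
  have f_add: "f (S + T) = f S + f T" for S T
  proof -
    obtain X where X: "proj_Cauchy X" "S = abs_proj_tensor X" by (rule proj_tensor_cases)
    obtain Y where Y: "proj_Cauchy Y" "T = abs_proj_tensor Y" by (rule proj_tensor_cases)
    have "S + T = abs_proj_tensor (\<lambda>n. X n + Y n)"
      using X Y by (simp add: plus_proj_tensor.abs_eq proj_rel_def)
    then have "(\<lambda>n. g (X n + Y n)) \<longlonglongrightarrow> f (S + T)"
      using f[OF proj_Cauchy_add[OF X(1) Y(1)]] by simp
    moreover have "(\<lambda>n. g (X n + Y n)) \<longlonglongrightarrow> f S + f T"
      using tendsto_add[OF f[OF X(1)] f[OF Y(1)]] by (simp only: g_add X(2) Y(2))
    ultimately show ?thesis by (rule LIMSEQ_unique)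
  qed
  have scaleC_cont: "bounded_linear (\<lambda>x::'c. c *\<^sub>C x)" for c
    by (rule bounded_linear_intro[of _ "cmod c"])
       (auto simp: scaleC_add_right scaleR_scaleC mult.commute)
  have f_scale: "f (c *\<^sub>C T) = c *\<^sub>C f T" for c T
  proof -
    obtain X where X: "proj_Cauchy X" "T = abs_proj_tensor X" by (rule proj_tensor_cases)
    have "c *\<^sub>C T = abs_proj_tensor (\<lambda>n. c *\<^sub>C X n)"
      using X by (simp add: scaleC_proj_tensor.abs_eq proj_rel_def)
    then have "(\<lambda>n. g (c *\<^sub>C X n)) \<longlonglongrightarrow> f (c *\<^sub>C T)"
      using f[OF proj_Cauchy_scale[OF X(1)]] by simp
    moreover have "(\<lambda>n. g (c *\<^sub>C X n)) \<longlonglongrightarrow> c *\<^sub>C f T"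
      using bounded_linear.tendsto[OF scaleC_cont f[OF X(1)]] by (simp only: g_scale X(2))
    ultimately show ?thesis by (rule LIMSEQ_unique)
  qed
  have f_bound: "norm (f T) \<le> norm T * K" for T
  proof -
    obtain X where X: "proj_Cauchy X" "T = abs_proj_tensor X" by (rule proj_tensor_cases)
    have "(\<lambda>n. norm (proj_embed (X n))) \<longlonglongrightarrow> norm T"
      using proj_embed_tendsto[OF X(1)] X(2) by (simp add: tendsto_norm)
    then have "(\<lambda>n. proj_norm (X n) * K) \<longlonglongrightarrow> norm T * K"
      by (simp add: norm_proj_embed tendsto_mult_right)
    from LIMSEQ_le[OF tendsto_norm[OF f[OF X(1)]] this] show ?thesis
      using g_bound X(2) by (auto simp: mult.commute)
  qed
  have "bounded_linear f"
    by (rule bounded_linear_intro[of _ K]) (auto simp: f_add f_scale scaleR_scaleC f_bound)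
  moreover have "f (tensor a b) = B a b" for a b
    using g[of "{#(a, b)#}"] by (simp add: tensor_def f_embed)
  ultimately show ?thesis using f_scale by (auto simp: bounded_clinear_def)
qed

lemma tensor_lift:
  assumes "bounded_cbilinear B"
  shows "bounded_clinear (tensor_lift B)" and "tensor_lift B (tensor a b) = B a b"
proof -
  obtain f where f: "bounded_clinear f" "\<And>a b. f (tensor a b) = B a b"
    using tensor_lift_exists[OF assms] by blast
  have "\<exists>!f. bounded_clinear f \<and> (\<forall>a b. f (tensor a b) = B a b)"
  proof (rule ex1I[of _ f])
    show "g = f" if "bounded_clinear g \<and> (\<forall>a b. g (tensor a b) = B a b)" for g
      using that f by (intro bounded_clinear_eq_on_tensors) auto
  qed (use f in simp)
  from theI'[OF this] show "bounded_clinear (tensor_lift B)" "tensor_lift B (tensor a b) = B a b"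
    unfolding tensor_lift_def by blast+
qed

lemma bounded_clinearD:
  assumes "bounded_clinear f"
  shows "f (x + y) = f x + f y" "f (c *\<^sub>C x) = c *\<^sub>C f x" "bounded_linear f"
proof -
  show "bounded_linear f" using assms by (simp add: bounded_clinear_def)
  then show "f (x + y) = f x + f y" by (rule linear_add[OF bounded_linear.linear])
  show "f (c *\<^sub>C x) = c *\<^sub>C f x" using assms by (simp add: bounded_clinear_def)
qed

lemma bounded_clinearI:
  assumes "\<And>x y. f (x + y) = f x + f y" "\<And>c x. f (c *\<^sub>C x) = c *\<^sub>C f x"
    "\<And>x. norm (f x) \<le> norm x * K"
  shows "bounded_clinear f"
proof -
  have "bounded_linear f"
    by (rule bounded_linear_intro[OF assms(1) _ assms(3)]) (simp only: scaleR_scaleC assms(2))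
  then show ?thesis by (simp add: bounded_clinear_def assms(2))
qed

lemma bounded_clinear_compose:
  assumes "bounded_clinear f" "bounded_clinear g" shows "bounded_clinear (\<lambda>x. f (g x))"
  using assms bounded_linear_compose[of f g] by (auto simp: bounded_clinear_def)

lemma bounded_cbilinearI:
  assumes "\<And>x x' y. B (x + x') y = B x y + B x' y" "\<And>x y y'. B x (y + y') = B x y + B x y'"
    "\<And>c x y. B (c *\<^sub>C x) y = c *\<^sub>C B x y" "\<And>c x y. B x (c *\<^sub>C y) = c *\<^sub>C B x y"
    "\<And>x y. norm (B x y) \<le> norm x * norm y * K"
  shows "bounded_cbilinear B"
proof -
  have "bounded_bilinear B"
  proof (rule bounded_bilinear.intro)
    show "\<exists>K. \<forall>x y. norm (B x y) \<le> norm x * norm y * K" using assms(5) by blast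
  qed (simp_all only: assms(1-4) scaleR_scaleC)
  then show ?thesis by (simp add: bounded_cbilinear_def assms(3,4))
qed

lemma norm_le_on_tensors:
  fixes f :: "('a::complex_normed_vector, 'b::complex_normed_vector) proj_tensor \<Rightarrow> 'c::complex_normed_vector"
  assumes f: "bounded_clinear f" and K: "0 \<le> K"
    and le: "\<And>a b. norm (f (tensor a b)) \<le> K * (norm a * norm b)"
  shows "norm (f T) \<le> K * norm T"
proof -
  have f0: "f 0 = 0" using bounded_clinearD(2)[OF f, of 0 0] by simp
  have formal: "norm (f (proj_embed (formal_sum M))) \<le> K * formal_norm M" for M :: "('a \<times> 'b) multiset"
  proof (induction M)
    case empty
    then show ?case by (simp add: proj_embed_zero f0)
  next
    case (add x M)
    obtain a b where x: "x = (a, b)" by (cases x)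
    show ?case
      using norm_triangle_ineq[of "f (tensor a b)" "f (proj_embed (formal_sum M))"] le[of a b] add
      by (simp add: x proj_embed_add bounded_clinearD(1)[OF f] algebra_simps flip: tensor_def)
  qed
  have alg: "norm (f (proj_embed u)) \<le> K * proj_norm u" for u :: "('a, 'b) alg_tensor"
  proof (rule field_le_epsilon)
    fix e :: real assume e: "0 < e"
    then have "0 < e / (K + 1)" using K by simp
    then obtain M where M: "formal_sum M = u" "formal_norm M < proj_norm u + e / (K + 1)"
      using proj_norm_approx[of u "proj_norm u + e / (K + 1)"] by auto
    have "norm (f (proj_embed u)) \<le> K * (proj_norm u + e / (K + 1))"
      using formal[of M] M K mult_left_mono[of "formal_norm M" "proj_norm u + e / (K + 1)" K] by simp
    also have "\<dots> = K * proj_norm u + e * (K / (K + 1))" by (simp add: distrib_left)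
    also have "e * (K / (K + 1)) \<le> e * 1" using e K by (intro mult_left_mono) auto
    finally show "norm (f (proj_embed u)) \<le> K * proj_norm u + e" by simp
  qed
  obtain X :: "nat \<Rightarrow> ('a, 'b) alg_tensor" where X: "proj_Cauchy X" "T = abs_proj_tensor X"
    by (rule proj_tensor_cases)
  note lim = proj_embed_tendsto[OF X(1), folded X(2)]
  show ?thesis
    by (rule LIMSEQ_le[OF tendsto_norm[OF bounded_linear.tendsto[OF bounded_clinearD(3)[OF f] lim]]
          tendsto_mult_left[OF tendsto_norm[OF lim]]])
       (auto simp: alg norm_proj_embed)
qed

definition Hom :: "('a::complex_banach_algebra \<Rightarrow> 'a) set"
  where "Hom = {\<sigma>. (\<forall>x y. \<sigma> (x + y) = \<sigma> x + \<sigma> y) \<and> (\<forall>c x. \<sigma> (c *\<^sub>C x) = c *\<^sub>C \<sigma> x) \<and>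
    (\<forall>x y. \<sigma> (x * y) = \<sigma> x * \<sigma> y) \<and> continuous_on UNIV \<sigma>}"

definition banach_bimodule ::
    "('a::complex_banach_algebra \<Rightarrow> 'x::complex_banach \<Rightarrow> 'x) \<Rightarrow> ('x \<Rightarrow> 'a \<Rightarrow> 'x) \<Rightarrow> bool"
  where "banach_bimodule l r \<longleftrightarrow> bounded_cbilinear l \<and> bounded_cbilinear r \<and>
    (\<forall>a b x. l (a * b) x = l a (l b x) \<and> r x (a * b) = r (r x a) b \<and> l a (r x b) = r (l a x) b)"

(* The actions on the dual of a bimodule with left action l and right action r. The left action
   on the dual comes from r and the right action from l; hence the bidual of (l, r) has the actions
   dual_left (dual_right l) and dual_right (dual_left r). *)
definition dual_left :: "('x::complex_banach \<Rightarrow> 'a::complex_banach_algebra \<Rightarrow> 'x) \<Rightarrow> 'a \<Rightarrow> 'x dual \<Rightarrow> 'x dual"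
  where "dual_left r a \<phi> = functional (\<lambda>x. dual_apply \<phi> (r x a))"

definition dual_right :: "('a::complex_banach_algebra \<Rightarrow> 'x::complex_banach \<Rightarrow> 'x) \<Rightarrow> 'x dual \<Rightarrow> 'a \<Rightarrow> 'x dual"
  where "dual_right l \<phi> a = functional (\<lambda>x. dual_apply \<phi> (l a x))"

definition tensor_left ::
    "'a::complex_banach_algebra \<Rightarrow> ('a, 'a) proj_tensor \<Rightarrow> ('a, 'a) proj_tensor"
  where "tensor_left a = tensor_lift (\<lambda>b c. tensor (a * b) c)"

definition tensor_right ::
    "('a::complex_banach_algebra, 'a) proj_tensor \<Rightarrow> 'a \<Rightarrow> ('a, 'a) proj_tensor"
  where "tensor_right u a = tensor_lift (\<lambda>b c. tensor b (c * a)) u"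

definition diagonal :: "('a::complex_banach_algebra, 'a) proj_tensor \<Rightarrow> 'a"
  where "diagonal = tensor_lift (*)"

(* dual_map and kappa use the function "functional" and so are meaningful for bounded
   complex-linear T (dual_map_apply) and for all x (kappa_apply). *)
definition dual_map :: "('x::complex_normed_vector \<Rightarrow> 'y::complex_normed_vector) \<Rightarrow> 'y dual \<Rightarrow> 'x dual"
  where "dual_map T \<phi> = functional (\<lambda>x. dual_apply \<phi> (T x))"

definition kappa :: "'x::complex_normed_vector \<Rightarrow> 'x dual dual"
  where "kappa x = functional (\<lambda>\<phi>. dual_apply \<phi> x)"

definition sigma_bimodule_hom ::
    "('a::complex_banach_algebra \<Rightarrow> 'a) \<Rightarrow>
     ('a \<Rightarrow> 'x::complex_banach \<Rightarrow> 'x) \<Rightarrow> ('x \<Rightarrow> 'a \<Rightarrow> 'x) \<Rightarrow>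
     ('a \<Rightarrow> 'y::complex_banach \<Rightarrow> 'y) \<Rightarrow> ('y \<Rightarrow> 'a \<Rightarrow> 'y) \<Rightarrow> ('x \<Rightarrow> 'y) \<Rightarrow> bool"
  where "sigma_bimodule_hom \<sigma> lX rX lY rY T \<longleftrightarrow> bounded_clinear T \<and>
    (\<forall>a x. T (lX a x) = lY (\<sigma> a) (T x)) \<and> (\<forall>a x. T (rX x a) = rY (T x) (\<sigma> a))"

definition sigma_biflat :: "('a::complex_banach_algebra \<Rightarrow> 'a) \<Rightarrow> bool"
  where "sigma_biflat \<sigma> \<longleftrightarrow>
    (\<exists>\<rho> :: ('a, 'a) proj_tensor dual \<Rightarrow> 'a dual. bounded_clinear \<rho> \<and>
      (\<forall>a \<phi>. \<rho> (dual_left tensor_right (\<sigma> a) \<phi>) = dual_left (*) a (\<rho> \<phi>)) \<and>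
      (\<forall>a \<phi>. \<rho> (dual_right tensor_left \<phi> (\<sigma> a)) = dual_right (*) (\<rho> \<phi>) a) \<and>
      \<rho> \<circ> dual_map diagonal = dual_map \<sigma>)"

lemma banach_bimodule_self: "banach_bimodule (*) ((*) :: 'a::complex_banach_algebra \<Rightarrow> _)"
  unfolding banach_bimodule_def
  by (auto intro!: bounded_cbilinearI[of _ 1] simp: norm_mult_ineq algebra_simps)

lemma bounded_cbilinear_dest:
  assumes "bounded_cbilinear B"
  shows "bounded_clinear (B x)" "bounded_clinear (\<lambda>x. B x y)"
  using assms bounded_bilinear.bounded_linear_left bounded_bilinear.bounded_linear_right
  by (auto simp: bounded_cbilinear_def bounded_clinear_def)

lemma dual_left_apply:
  assumes "banach_bimodule l r" shows "dual_apply (dual_left r a \<phi>) x = dual_apply \<phi> (r x a)"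
proof -
  have "bounded_clinear (\<lambda>x. dual_apply \<phi> (r x a))"
    by (rule bounded_clinear_compose[OF bounded_clinear_dual_apply bounded_cbilinear_dest(2)])
       (use assms in \<open>simp add: banach_bimodule_def\<close>)
  then show ?thesis by (simp add: dual_left_def dual_apply_functional)
qed

lemma dual_right_apply:
  assumes "banach_bimodule l r" shows "dual_apply (dual_right l \<phi> a) x = dual_apply \<phi> (l a x)"
proof -
  have "bounded_clinear (\<lambda>x. dual_apply \<phi> (l a x))"
    by (rule bounded_clinear_compose[OF bounded_clinear_dual_apply bounded_cbilinear_dest(1)])
       (use assms in \<open>simp add: banach_bimodule_def\<close>)
  then show ?thesis by (simp add: dual_right_def dual_apply_functional)
qed

lemma dual_map_apply:
  assumes "bounded_clinear T" shows "dual_apply (dual_map T \<phi>) x = dual_apply \<phi> (T x)"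
  using bounded_clinear_compose[OF bounded_clinear_dual_apply assms]
  by (simp add: dual_map_def dual_apply_functional)

lemma bounded_clinear_dual_map:
  assumes T: "bounded_clinear T" shows "bounded_clinear (dual_map T)"
proof -
  obtain K where K: "0 < K" "\<And>x. norm (T x) \<le> norm x * K"
    using bounded_linear.pos_bounded[OF bounded_clinearD(3)[OF T]] by blast
  have "norm (dual_map T \<phi>) \<le> norm \<phi> * K" for \<phi>
  proof (rule norm_dual_bound)
    show "norm (dual_apply (dual_map T \<phi>) x) \<le> norm \<phi> * K * norm x" for x
      using order_trans[OF norm_dual_apply mult_left_mono[OF K(2)[of x] norm_ge_zero[of \<phi>]]]
      by (simp add: dual_map_apply[OF T] mult_ac)
  qed (use K in simp)
  then show ?thesis
    by (intro bounded_clinearI[of _ K] dual_eqI) (simp_all add: dual_map_apply[OF T] dual_apply_simps)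
qed

lemma kappa_apply: "dual_apply (kappa x) \<phi> = dual_apply \<phi> x"
proof -
  have "bounded_clinear (\<lambda>\<phi>. dual_apply \<phi> x)"
    by (rule bounded_clinearI[of _ "norm x"]) (simp_all add: dual_apply_simps norm_dual_apply)
  then show ?thesis by (simp add: kappa_def dual_apply_functional)
qed

lemma banach_bimodule_dual:
  assumes m: "banach_bimodule l r"
  shows "banach_bimodule (dual_left r) (dual_right l)"
proof -
  have l: "bounded_cbilinear l" and r: "bounded_cbilinear r" using m by (auto simp: banach_bimodule_def)
  note ap = dual_left_apply[OF m] dual_right_apply[OF m] dual_apply_simps
  note lin = bounded_clinearD(1,2)[OF bounded_cbilinear_dest(1)[OF l]]
    bounded_clinearD(1,2)[OF bounded_cbilinear_dest(2)[OF l]]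
    bounded_clinearD(1,2)[OF bounded_cbilinear_dest(1)[OF r]]
    bounded_clinearD(1,2)[OF bounded_cbilinear_dest(2)[OF r]]
    bounded_clinearD(1,2)[OF bounded_clinear_dual_apply]
  obtain K where K: "0 < K" "\<And>a x. norm (l a x) \<le> norm a * norm x * K"
    using l bounded_bilinear.pos_bounded unfolding bounded_cbilinear_def by blast
  obtain L where L: "0 < L" "\<And>x a. norm (r x a) \<le> norm x * norm a * L"
    using r bounded_bilinear.pos_bounded unfolding bounded_cbilinear_def by blast
  have nl: "norm (dual_left r a \<phi>) \<le> norm a * norm \<phi> * L" for a \<phi>
  proof (rule norm_dual_bound)
    show "norm (dual_apply (dual_left r a \<phi>) x) \<le> norm a * norm \<phi> * L * norm x" for x
      using order_trans[OF norm_dual_apply mult_left_mono[OF L(2)[of x a] norm_ge_zero[of \<phi>]]]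
      by (simp add: ap mult_ac)
  qed (use L in simp)
  have nr: "norm (dual_right l \<phi> a) \<le> norm \<phi> * norm a * K" for a \<phi>
  proof (rule norm_dual_bound)
    show "norm (dual_apply (dual_right l \<phi> a) x) \<le> norm \<phi> * norm a * K * norm x" for x
      using order_trans[OF norm_dual_apply mult_left_mono[OF K(2)[of a x] norm_ge_zero[of \<phi>]]]
      by (simp add: ap mult_ac)
  qed (use K in simp)
  have "bounded_cbilinear (dual_left r)"
    by (rule bounded_cbilinearI[OF _ _ _ _ nl]; rule dual_eqI; simp add: ap lin)
  moreover have "bounded_cbilinear (dual_right l)"
    by (rule bounded_cbilinearI[OF _ _ _ _ nr]; rule dual_eqI; simp add: ap lin)
  ultimately show ?thesis
    using m by (auto simp: banach_bimodule_def ap intro!: dual_eqI)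
qed

lemma bounded_cbilinear_tensor_left_aux:
  "bounded_cbilinear (\<lambda>b c. tensor ((a::'a::complex_banach_algebra) * b) (c::'a))"
proof (rule bounded_cbilinearI[of _ "norm a"])
  show "norm (tensor (a * b) c) \<le> norm b * norm c * norm a" for b c
    using order_trans[OF norm_tensor_le mult_right_mono[OF norm_mult_ineq[of a b] norm_ge_zero[of c]]]
    by (simp add: mult_ac)
qed (simp_all add: tensor_simps distrib_left)

lemma bounded_cbilinear_tensor_right_aux:
  "bounded_cbilinear (\<lambda>b c. tensor (b::'a) (c * (a::'a::complex_banach_algebra)))"
proof (rule bounded_cbilinearI[of _ "norm a"])
  show "norm (tensor b (c * a)) \<le> norm b * norm c * norm a" for b c
    using order_trans[OF norm_tensor_le mult_left_mono[OF norm_mult_ineq[of c a] norm_ge_zero[of b]]]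
    by (simp add: mult_ac)
qed (simp_all add: tensor_simps distrib_right)

lemma tensor_left_tensor: "tensor_left a (tensor b c) = tensor (a * b) c"
  and bounded_clinear_tensor_left: "bounded_clinear (tensor_left a)"
  unfolding tensor_left_def using tensor_lift[OF bounded_cbilinear_tensor_left_aux] by auto

lemma tensor_right_tensor: "tensor_right (tensor b c) a = tensor b (c * a)"
  and bounded_clinear_tensor_right: "bounded_clinear (\<lambda>u. tensor_right u a)"
  unfolding tensor_right_def using tensor_lift[OF bounded_cbilinear_tensor_right_aux] by auto

lemma bounded_cbilinear_mult: "bounded_cbilinear ((*) :: 'a::complex_banach_algebra \<Rightarrow> _)"
  using banach_bimodule_self[where 'a = 'a] by (simp add: banach_bimodule_def)

lemma diagonal_tensor: "diagonal (tensor a b) = a * b"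
  unfolding diagonal_def by (rule tensor_lift(2)[OF bounded_cbilinear_mult])

lemma bounded_clinear_diagonal: "bounded_clinear diagonal"
  unfolding diagonal_def by (rule tensor_lift(1)[OF bounded_cbilinear_mult])

lemma bounded_clinear_add:
  assumes "bounded_clinear f" "bounded_clinear g" shows "bounded_clinear (\<lambda>x. f x + g x)"
  using assms bounded_linear_add[of f g] by (auto simp: bounded_clinear_def scaleC_add_right)

lemma bounded_clinear_scaleC:
  assumes "bounded_clinear f" shows "bounded_clinear (\<lambda>x. c *\<^sub>C f x)"
proof -
  have "bounded_clinear (\<lambda>x::'b. c *\<^sub>C x)"
    by (rule bounded_clinearI[of _ "cmod c"]) (auto simp: scaleC_add_right mult.commute)
  from bounded_clinear_compose[OF this assms] show ?thesis .
qed

lemma banach_bimodule_tensor: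
  "banach_bimodule tensor_left (tensor_right :: ('a::complex_banach_algebra, 'a) proj_tensor \<Rightarrow> _)"
proof -
  note bl = bounded_clinear_tensor_left bounded_clinear_tensor_right
  note ev = tensor_left_tensor tensor_right_tensor tensor_simps algebra_simps
  note eqI = bounded_clinear_eq_on_tensors[THEN fun_cong]
  have nl: "norm (tensor_left a u) \<le> norm a * norm u * 1" for a :: 'a and u
  proof -
    have "norm (tensor_left a (tensor b c)) \<le> norm a * (norm b * norm c)" for b c
      using order_trans[OF norm_tensor_le mult_right_mono[OF norm_mult_ineq[of a b] norm_ge_zero[of c]]]
      by (simp add: tensor_left_tensor mult.assoc)
    from norm_le_on_tensors[OF bl(1) norm_ge_zero this] show ?thesis by simp
  qed
  have nr: "norm (tensor_right u a) \<le> norm u * norm a * 1" for a :: 'a and u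
  proof -
    have "norm (tensor_right (tensor b c) a) \<le> norm a * (norm b * norm c)" for b c
      using order_trans[OF norm_tensor_le mult_left_mono[OF norm_mult_ineq[of c a] norm_ge_zero[of b]]]
      by (simp add: tensor_right_tensor mult_ac)
    from norm_le_on_tensors[OF bl(2) norm_ge_zero this] show ?thesis by (simp add: mult.commute)
  qed
  have "bounded_cbilinear (tensor_left :: 'a \<Rightarrow> _)"
  proof (rule bounded_cbilinearI[OF _ _ _ _ nl])
    show "tensor_left (a + a') u = tensor_left a u + tensor_left a' u" for a a' :: 'a and u
      by (rule eqI[OF bl(1) bounded_clinear_add[OF bl(1) bl(1)]]) (simp add: ev)
    show "tensor_left (c *\<^sub>C a) u = c *\<^sub>C tensor_left a u" for c and a :: 'a and u
      by (rule eqI[OF bl(1) bounded_clinear_scaleC[OF bl(1)]]) (simp add: ev)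
  qed (simp_all add: bounded_clinearD[OF bl(1)])
  moreover have "bounded_cbilinear (tensor_right :: ('a, 'a) proj_tensor \<Rightarrow> _)"
  proof (rule bounded_cbilinearI[OF _ _ _ _ nr])
    show "tensor_right u (a + a') = tensor_right u a + tensor_right u a'" for a a' :: 'a and u
      by (rule eqI[OF bl(2) bounded_clinear_add[OF bl(2) bl(2)]]) (simp add: ev)
    show "tensor_right u (c *\<^sub>C a) = c *\<^sub>C tensor_right u a" for c and a :: 'a and u
      by (rule eqI[OF bl(2) bounded_clinear_scaleC[OF bl(2)]]) (simp add: ev)
  qed (simp_all add: bounded_clinearD[OF bl(2)])
  moreover have "tensor_left (a * b) u = tensor_left a (tensor_left b u)" for a b :: 'a and u
    by (rule eqI[OF bl(1) bounded_clinear_compose[OF bl(1) bl(1)]]) (simp add: ev)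
  moreover have "tensor_right u (a * b) = tensor_right (tensor_right u a) b" for a b :: 'a and u
    by (rule eqI[OF bl(2) bounded_clinear_compose[OF bl(2) bl(2)]]) (simp add: ev)
  moreover have "tensor_left a (tensor_right u b) = tensor_right (tensor_left a u) b" for a b :: 'a and u
    by (rule eqI[OF bounded_clinear_compose[OF bl(1) bl(2)] bounded_clinear_compose[OF bl(2) bl(1)]])
       (simp add: ev)
  ultimately show ?thesis by (simp add: banach_bimodule_def)
qed

end

theory Submission
  imports Defs
begin

text \<open>
  A bounded operator \<open>\<rho>\<close> from \<open>X\<close> to the dual of \<open>Y\<close> and its transpose \<open>\<tau>\<close> from \<open>Y\<close> to the dual
  of \<open>X\<close> carry the same information: both encode the bounded bilinear form
  \<open>\<langle>\<rho>(x), y\<rangle> = \<langle>\<tau>(y), x\<rangle>\<close>. Take for \<open>X\<close> the dual of the projective tensor square of the algebra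
  \<open>A\<close>, and for \<open>Y\<close> the algebra \<open>A\<close> itself. Then \<open>\<rho>\<close> has the shape of an operator witnessing
  \<open>\<sigma>\<close>-biflatness, and \<open>\<tau>\<close> maps \<open>A\<close> into the bidual of the tensor square. Written in terms of the
  bilinear form, the module identities and the factorisation identity required of \<open>\<rho>\<close> are
  precisely those required of \<open>\<tau>\<close>; a left-module identity for one is a right-module identity for the
  other.
  So transposition turns the witnesses of either condition into witnesses of the other.
\<close>

lemma bounded_clinear_if_continuous:
  fixes f :: "'a::complex_normed_vector \<Rightarrow> 'b::complex_normed_vector"
  assumes add: "\<And>x y. f (x + y) = f x + f y" and scale: "\<And>c x. f (c *\<^sub>C x) = c *\<^sub>C f x"
    and cont: "continuous_on UNIV f"
  shows "bounded_clinear f"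
proof -
  have scaleR: "f (r *\<^sub>R x) = r *\<^sub>R f x" for r x
    by (simp add: scaleR_scaleC scale)
  then have f0: "f 0 = 0"
    using scaleR[of 0 0] by simp
  obtain d where d: "0 < d" "\<And>x. norm x < d \<Longrightarrow> norm (f x) < 1"
    using cont[unfolded continuous_on_iff, rule_format, of 0 1] by (auto simp: f0)
  have "norm (f x) \<le> norm x * (2 / d)" for x
  proof (cases "x = 0")
    case False
    define r where "r = d / (2 * norm x)"
    have r: "0 < r" "norm (r *\<^sub>R x) < d"
      using d(1) False by (simp_all add: r_def)
    have "r * norm (f x) < 1"
      using d(2)[OF r(2)] r(1) by (simp add: scaleR)
    then show ?thesis
      using d(1) False by (simp add: r_def field_simps)
  qed (simp add: f0)
  then show ?thesis
    by (rule bounded_clinearI[OF add scale])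
qed

text \<open>
  The transpose of \<open>T\<close>, from \<open>X\<close> to the dual of \<open>Y\<close>, sends \<open>y\<close> to evaluation at \<open>y\<close> following \<open>T\<close>; in other words it is
  the adjoint of \<open>T\<close> restricted to the canonical image of \<open>Y\<close> in its bidual. As with \<open>dual_map\<close>, it is
  meaningful only for bounded complex-linear \<open>T\<close>.
\<close>
definition dual_transpose ::
    "('x::complex_normed_vector \<Rightarrow> 'y::complex_normed_vector dual) \<Rightarrow> 'y \<Rightarrow> 'x dual"
  where "dual_transpose T y = dual_map T (kappa y)"

lemma dual_transpose_apply:
  assumes "bounded_clinear T"
  shows "dual_apply (dual_transpose T y) x = dual_apply (T x) y"
  by (simp add: dual_transpose_def dual_map_apply[OF assms] kappa_apply)

lemma bounded_clinear_kappa: "bounded_clinear kappa"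
proof (rule bounded_clinearI)
  show "norm (kappa x) \<le> norm x * 1" for x :: 'a
    by (rule norm_dual_bound)
      (use norm_dual_apply in \<open>auto simp: kappa_apply mult.commute\<close>)
qed (auto intro!: dual_eqI
      simp: kappa_apply dual_apply_simps bounded_clinearD[OF bounded_clinear_dual_apply])

lemma bounded_clinear_dual_transpose:
  assumes "bounded_clinear T"
  shows "bounded_clinear (dual_transpose T)"
  unfolding dual_transpose_def
  by (rule bounded_clinear_compose[OF bounded_clinear_dual_map[OF assms] bounded_clinear_kappa])

text \<open>
  Every identity in either notion is one between functionals, so it can be tested on arguments;
  with the bilinear form \<open>\<langle>\<rho>(\<phi>), x\<rangle>\<close> the two lists of identities then coincide.
\<close>
lemma sigma_biflat_conditions_iff_transpose:
  fixes \<sigma> :: "'a::complex_banach_algebra \<Rightarrow> 'a"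
    and \<rho> :: "('a, 'a) proj_tensor dual \<Rightarrow> 'a dual"
    and \<tau> :: "'a \<Rightarrow> ('a, 'a) proj_tensor dual dual"
  assumes \<sigma>: "bounded_clinear \<sigma>"
    and form: "\<And>\<phi> x. dual_apply (\<tau> x) \<phi> = dual_apply (\<rho> \<phi>) x"
  shows "(\<forall>a \<phi>. \<rho> (dual_left tensor_right (\<sigma> a) \<phi>) = dual_left (*) a (\<rho> \<phi>)) \<longleftrightarrow>
      (\<forall>a x. \<tau> (x * a) = dual_right (dual_left tensor_right) (\<tau> x) (\<sigma> a))" (is "?L1 \<longleftrightarrow> ?R1")
    and "(\<forall>a \<phi>. \<rho> (dual_right tensor_left \<phi> (\<sigma> a)) = dual_right (*) (\<rho> \<phi>) a) \<longleftrightarrow>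
      (\<forall>a x. \<tau> (a * x) = dual_left (dual_right tensor_left) (\<sigma> a) (\<tau> x))" (is "?L2 \<longleftrightarrow> ?R2")
    and "\<rho> \<circ> dual_map diagonal = dual_map \<sigma> \<longleftrightarrow>
      dual_map (dual_map diagonal) \<circ> \<tau> = kappa \<circ> \<sigma>" (is "?L3 \<longleftrightarrow> ?R3")
proof -
  have ext: "\<phi> = \<psi> \<longleftrightarrow> (\<forall>x. dual_apply \<phi> x = dual_apply \<psi> x)"
    for \<phi> \<psi> :: "'b::complex_normed_vector dual"
    by (auto intro: dual_eqI)
  note actions = dual_left_apply[OF banach_bimodule_self] dual_right_apply[OF banach_bimodule_self]
    dual_left_apply[OF banach_bimodule_dual[OF banach_bimodule_tensor]]
    dual_right_apply[OF banach_bimodule_dual[OF banach_bimodule_tensor]]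
  show "?L1 \<longleftrightarrow> ?R1" "?L2 \<longleftrightarrow> ?R2"
    by (auto simp: ext actions form)
  show "?L3 \<longleftrightarrow> ?R3"
    by (auto simp: fun_eq_iff ext form kappa_apply dual_map_apply[OF \<sigma>]
        dual_map_apply[OF bounded_clinear_dual_map[OF bounded_clinear_diagonal]])
qed

theorem theorem2p3:
  fixes \<sigma> :: "'a::complex_banach_algebra \<Rightarrow> 'a"
  assumes "\<sigma> \<in> Hom"
  shows "sigma_biflat \<sigma> \<longleftrightarrow>
    (\<exists>\<rho> :: 'a \<Rightarrow> ('a, 'a) proj_tensor dual dual.
      sigma_bimodule_hom \<sigma> (*) (*)
        (dual_left (dual_right tensor_left)) (dual_right (dual_left tensor_right)) \<rho> \<and>
      dual_map (dual_map diagonal) \<circ> \<rho> = kappa \<circ> \<sigma>)"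
proof -
  have \<sigma>: "bounded_clinear \<sigma>"
    using assms by (intro bounded_clinear_if_continuous) (simp_all add: Hom_def)
  note conditions = sigma_biflat_conditions_iff_transpose[OF \<sigma>]
  show ?thesis
  proof
    assume "sigma_biflat \<sigma>"
    then obtain \<rho> where \<rho>: "bounded_clinear \<rho>"
      "\<forall>a \<phi>. \<rho> (dual_left tensor_right (\<sigma> a) \<phi>) = dual_left (*) a (\<rho> \<phi>)"
      "\<forall>a \<phi>. \<rho> (dual_right tensor_left \<phi> (\<sigma> a)) = dual_right (*) (\<rho> \<phi>) a"
      "\<rho> \<circ> dual_map diagonal = dual_map \<sigma>"
      unfolding sigma_biflat_def by blast
    note iffs = conditions[of "dual_transpose \<rho>" \<rho>, OF dual_transpose_apply[OF \<rho>(1)]]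
    show "\<exists>\<tau>. sigma_bimodule_hom \<sigma> (*) (*)
          (dual_left (dual_right tensor_left)) (dual_right (dual_left tensor_right)) \<tau> \<and>
        dual_map (dual_map diagonal) \<circ> \<tau> = kappa \<circ> \<sigma>"
      unfolding sigma_bimodule_hom_def
      using bounded_clinear_dual_transpose[OF \<rho>(1)] \<rho>(2-4)[unfolded iffs] by blast
  next
    assume "\<exists>\<tau>. sigma_bimodule_hom \<sigma> (*) (*)
          (dual_left (dual_right tensor_left)) (dual_right (dual_left tensor_right)) \<tau> \<and>
        dual_map (dual_map diagonal) \<circ> \<tau> = kappa \<circ> \<sigma>"
    then obtain \<tau> where \<tau>: "bounded_clinear \<tau>"
      "\<forall>a x. \<tau> (x * a) = dual_right (dual_left tensor_right) (\<tau> x) (\<sigma> a)"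
      "\<forall>a x. \<tau> (a * x) = dual_left (dual_right tensor_left) (\<sigma> a) (\<tau> x)"
      "dual_map (dual_map diagonal) \<circ> \<tau> = kappa \<circ> \<sigma>"
      unfolding sigma_bimodule_hom_def by blast
    note iffs = conditions[of \<tau> "dual_transpose \<tau>", OF dual_transpose_apply[OF \<tau>(1), symmetric]]
    show "sigma_biflat \<sigma>"
      unfolding sigma_biflat_def
      using bounded_clinear_dual_transpose[OF \<tau>(1)] \<tau>(2-4)[folded iffs] by blast
  qed
qed

end
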